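(* (Mackey formula) Let $A$ be an abelian group, let $G,H,K$ be finite groups, and let $(U,\phi)\in\mathcal{M}_{G\times H}$ and $(V,\psi)\in\mathcal{M}_{H\times K}$. For $t\in H$ set $H_t:=k_2(U)\cap {}^t k_1(V)$. There exists an isomorphism of $A$-fibered $(G,K)$-bisets $$\left(\frac{G\times H}{U,\phi}\right)\otimes_{AH}\left(\frac{H\times K}{V,\psi}\right)\cong\coprod_{\substack{t\in p_2(U)\backslash H/p_1(V)\\ \phi_2|_{H_t}={}^t\psi_1|_{H_t}}}\left(\frac{G\times K}{U*{}^{(t,1)}V,\ \phi*{}^{(t,1)}\psi}\right),$$ where $t$ runs over those elements of a set of representatives of the double cosets $p_2(U)\backslash H/p_1(V)$ satisfying the indicated condition. The isomorphism can be chosen such that its inverse (from right to left) maps the trivial coset of the $t$-component to the class of the pair $(U_\phi,(1,t,1)V_\psi)$, where $U_\phi$ and $V_\psi$ also denote the trivial cosets in $(A\times G\times H)/U_\phi$ and $(A\times H\times K)/V_\psi$.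
   Context: $A$ is written multiplicatively. For a finite group $U$, $U^*=\mathrm{Hom}(U,A)$. $\mathcal{M}_G$ is the set of pairs $(K,\kappa)$ with $K\le G$ and $\kappa\in K^*$. Conjugation: ${}^gK=gKg^{-1}$ and ${}^g\kappa\in({}^gK)^*$ is ${}^g\kappa(gxg^{-1})=\kappa(x)$. For $(U,\phi)\in\mathcal{M}_{G\times H}$: $p_1(U)\le G$, $p_2(U)\le H$ are the projections of $U$, $k_1(U)=\{g\in G:(g,1)\in U\}$, $k_2(U)=\{h\in H:(1,h)\in U\}$, and $\phi_i\in k_i(U)^*$ are defined by $\phi(g,h)=\phi_1(g)\phi_2(h)^{-1}$ for $(g,h)\in k_1(U)\times k_2(U)$. An $A$-fibered $(G,H)$-biset is a left $A\times G\times H$-set which is free as an $A$-set and has finitely many $A$-orbits; isomorphisms are $A\times G\times H$-equivariant bijections. $\left(\frac{G\times H}{U,\phi}\right)=(A\times G\times H)/U_\phi$ with $U_\phi=\{(\phi(u)^{-1},u):u\in U\}$. For an $A$-fibered $(G,H)$-biset $X$ and an $A$-fibered $(H,K)$-biset $Y$, let $A\times H$ act on $X\times Y$ by $(a,h)\cdot(x,y)=((a^{-1},1,h)x,(a,h,1)y)$; the set of orbits $[x,y]$ is an $A\times G\times K$-set via $(a,g,k)[x,y]=[(a,g,1)x,(1,1,k)y]$, and $X\otimes_{AH}Y$ is its subset of elements with trivial stabilizer in $A$; it is an $A$-fibered $(G,K)$-biset. For $U\le G\times H$, $V\le H\times K$: $U*V=\{(g,k)\in G\times K:\exists h\in H,\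 (g,h)\in U,\ (h,k)\in V\}$. If $\phi\in U^*$, $\psi\in V^*$ satisfy $\phi_2=\psi_1$ on $k_2(U)\cap k_1(V)$, then $\phi*\psi\in(U*V)^*$ is defined by $(\phi*\psi)(g,k)=\phi(g,h)\psi(h,k)$ for any $h\in H$ with $(g,h)\in U$ and $(h,k)\in V$ (independent of the choice of $h$). *)

theory Defs
  imports "HOL-Algebra.Group_Action" "HOL-Algebra.Left_Coset"
begin

text \<open>
  A character \<open>\<kappa>\<close> of a subgroup \<open>U\<close> is represented by a function on the ambient type; only its
  values on \<open>U\<close> matter. The triple product \<open>A \<times> G \<times> H\<close> is \<open>A \<times>\<times> G \<times>\<times> H\<close>, with elements \<open>(a, g, h)\<close>.
\<close>

definition char_pairs :: "('a, 'm) monoid_scheme \<Rightarrow> ('g, 'n) monoid_scheme \<Rightarrow> ('g set \<times> ('g \<Rightarrow> 'a)) set"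
  where "char_pairs A G = {(U, \<phi>). subgroup U G \<and> \<phi> \<in> hom (G\<lparr>carrier := U\<rparr>) A}"

definition conj_set :: "('g, 'n) monoid_scheme \<Rightarrow> 'g \<Rightarrow> 'g set \<Rightarrow> 'g set"
  where "conj_set G g U = g <#\<^bsub>G\<^esub> U #>\<^bsub>G\<^esub> inv\<^bsub>G\<^esub> g"

definition conj_char :: "('g, 'n) monoid_scheme \<Rightarrow> 'g \<Rightarrow> ('g \<Rightarrow> 'a) \<Rightarrow> 'g \<Rightarrow> 'a"
  where "conj_char G g \<kappa> = (\<lambda>y. \<kappa> (inv\<^bsub>G\<^esub> g \<otimes>\<^bsub>G\<^esub> y \<otimes>\<^bsub>G\<^esub> g))"

lemma (in group) conj_char_conj:
  assumes "g \<in> carrier G" "x \<in> carrier G"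
  shows "conj_char G g \<kappa> (g \<otimes> x \<otimes> inv g) = \<kappa> x"
  using conjugation_is_surj[of "inv g" x] assms by (simp add: conj_char_def)

definition k1 :: "('g, 'n) monoid_scheme \<Rightarrow> ('h, 'o) monoid_scheme \<Rightarrow> ('g \<times> 'h) set \<Rightarrow> 'g set"
  where "k1 G H U = {g \<in> carrier G. (g, \<one>\<^bsub>H\<^esub>) \<in> U}"

definition k2 :: "('g, 'n) monoid_scheme \<Rightarrow> ('h, 'o) monoid_scheme \<Rightarrow> ('g \<times> 'h) set \<Rightarrow> 'h set"
  where "k2 G H U = {h \<in> carrier H. (\<one>\<^bsub>G\<^esub>, h) \<in> U}"

text \<open>
  The characters \<open>\<phi>\<^sub>1\<close>, \<open>\<phi>\<^sub>2\<close> are determined by \<open>\<phi> (g, h) = \<phi>\<^sub>1 g \<otimes> inv (\<phi>\<^sub>2 h)\<close> on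
  \<open>k1 G H U \<times> k2 G H U\<close>; see the lemma \<open>char_decomp\<close>. Note the inverse in \<open>char2\<close>.
\<close>

definition char1 :: "('h, 'o) monoid_scheme \<Rightarrow> ('g \<times> 'h \<Rightarrow> 'a) \<Rightarrow> 'g \<Rightarrow> 'a"
  where "char1 H \<phi> = (\<lambda>g. \<phi> (g, \<one>\<^bsub>H\<^esub>))"

definition char2 :: "('a, 'm) monoid_scheme \<Rightarrow> ('g, 'n) monoid_scheme \<Rightarrow> ('g \<times> 'h \<Rightarrow> 'a) \<Rightarrow> 'h \<Rightarrow> 'a"
  where "char2 A G \<phi> = (\<lambda>h. inv\<^bsub>A\<^esub> (\<phi> (\<one>\<^bsub>G\<^esub>, h)))"

lemma char_decomp:
  assumes "comm_group A" "group G" "group H" and \<phi>: "(U, \<phi>) \<in> char_pairs A (G \<times>\<times> H)"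
    and g: "g \<in> k1 G H U" and h: "h \<in> k2 G H U"
  shows "\<phi> (g, h) = char1 H \<phi> g \<otimes>\<^bsub>A\<^esub> inv\<^bsub>A\<^esub> (char2 A G \<phi> h)"
proof -
  interpret A: comm_group A by fact
  interpret G: group G by fact
  interpret H: group H by fact
  have hom: "\<phi> \<in> hom ((G \<times>\<times> H)\<lparr>carrier := U\<rparr>) A"
    using \<phi> by (simp add: char_pairs_def)
  have "\<phi> ((g, \<one>\<^bsub>H\<^esub>) \<otimes>\<^bsub>G \<times>\<times> H\<^esub> (\<one>\<^bsub>G\<^esub>, h)) = \<phi> (g, \<one>\<^bsub>H\<^esub>) \<otimes>\<^bsub>A\<^esub> \<phi> (\<one>\<^bsub>G\<^esub>, h)"
    by (rule hom_mult[OF hom, simplified]) (use g h in \<open>simp_all add: k1_def k2_def\<close>)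
  moreover have "\<phi> (\<one>\<^bsub>G\<^esub>, h) \<in> carrier A"
    using hom_in_carrier[OF hom] h by (simp add: k2_def)
  ultimately show ?thesis
    using g h by (simp add: char1_def char2_def k1_def k2_def)
qed

text \<open>
  For subgroups \<open>U\<close> of \<open>G \<times>\<times> H\<close> and \<open>V\<close> of \<open>H \<times>\<times> K\<close>, the product \<open>U * V\<close> is the relational
  composition \<open>U O V\<close>.
\<close>

definition star_char ::
    "('a, 'm) monoid_scheme \<Rightarrow> ('g \<times> 'h) set \<Rightarrow> ('h \<times> 'k) set \<Rightarrow> ('g \<times> 'h \<Rightarrow> 'a) \<Rightarrow> ('h \<times> 'k \<Rightarrow> 'a) \<Rightarrow> 'g \<times> 'k \<Rightarrow> 'a"
  where "star_char A U V \<phi> \<psi> =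
    (\<lambda>(g, k). let h = (SOME h. (g, h) \<in> U \<and> (h, k) \<in> V) in \<phi> (g, h) \<otimes>\<^bsub>A\<^esub> \<psi> (h, k))"

lemma star_char_eq:
  assumes "comm_group A" "group G" "group H" "group K"
    and \<phi>: "(U, \<phi>) \<in> char_pairs A (G \<times>\<times> H)" and \<psi>: "(V, \<psi>) \<in> char_pairs A (H \<times>\<times> K)"
    and eq: "\<And>h. h \<in> k2 G H U \<inter> k1 H K V \<Longrightarrow> char2 A G \<phi> h = char1 K \<psi> h"
    and gh: "(g, h) \<in> U" and hk: "(h, k) \<in> V"
  shows "star_char A U V \<phi> \<psi> (g, k) = \<phi> (g, h) \<otimes>\<^bsub>A\<^esub> \<psi> (h, k)"
proof -
  interpret A: comm_group A by fact
  interpret G: group G by fact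
  interpret H: group H by fact
  interpret K: group K by fact
  interpret GH: group "G \<times>\<times> H" by (rule DirProd_group) fact+
  interpret HK: group "H \<times>\<times> K" by (rule DirProd_group) fact+
  have U: "subgroup U (G \<times>\<times> H)" and hom\<phi>: "\<phi> \<in> hom ((G \<times>\<times> H)\<lparr>carrier := U\<rparr>) A"
    using \<phi> by (simp_all add: char_pairs_def)
  have V: "subgroup V (H \<times>\<times> K)" and hom\<psi>: "\<psi> \<in> hom ((H \<times>\<times> K)\<lparr>carrier := V\<rparr>) A"
    using \<psi> by (simp_all add: char_pairs_def)
  define h' where "h' = (SOME h. (g, h) \<in> U \<and> (h, k) \<in> V)"
  have h': "(g, h') \<in> U" "(h', k) \<in> V"
    using someI[of "\<lambda>h. (g, h) \<in> U \<and> (h, k) \<in> V"] gh hk unfolding h'_def by blast+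
  have c: "g \<in> carrier G" "h \<in> carrier H" "k \<in> carrier K" "h' \<in> carrier H"
    using subgroup.mem_carrier[OF U gh] subgroup.mem_carrier[OF V hk] subgroup.mem_carrier[OF U h'(1)]
    by auto
  define x where "x = h' \<otimes>\<^bsub>H\<^esub> inv\<^bsub>H\<^esub> h"
  have x: "x \<in> carrier H" "x \<otimes>\<^bsub>H\<^esub> h = h'" using c by (simp_all add: x_def H.m_assoc)
  have "(g, h') \<otimes>\<^bsub>G \<times>\<times> H\<^esub> inv\<^bsub>G \<times>\<times> H\<^esub> (g, h) \<in> U"
    by (intro subgroup.m_closed[OF U] subgroup.m_inv_closed[OF U] h' gh)
  then have xU: "(\<one>\<^bsub>G\<^esub>, x) \<in> U"
    using c by (simp add: x_def inv_DirProd[OF assms(2,3)])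
  have "(h', k) \<otimes>\<^bsub>H \<times>\<times> K\<^esub> inv\<^bsub>H \<times>\<times> K\<^esub> (h, k) \<in> V"
    by (intro subgroup.m_closed[OF V] subgroup.m_inv_closed[OF V] h' hk)
  then have xV: "(x, \<one>\<^bsub>K\<^esub>) \<in> V"
    using c by (simp add: x_def inv_DirProd[OF assms(3,4)])
  have car: "\<phi> (\<one>\<^bsub>G\<^esub>, x) \<in> carrier A" "\<psi> (x, \<one>\<^bsub>K\<^esub>) \<in> carrier A"
      "\<phi> (g, h) \<in> carrier A" "\<psi> (h, k) \<in> carrier A"
    using hom_in_carrier[OF hom\<phi>] hom_in_carrier[OF hom\<psi>] xU xV gh hk by simp_all
  have "\<phi> ((\<one>\<^bsub>G\<^esub>, x) \<otimes>\<^bsub>G \<times>\<times> H\<^esub> (g, h)) = \<phi> (\<one>\<^bsub>G\<^esub>, x) \<otimes>\<^bsub>A\<^esub> \<phi> (g, h)"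
    by (rule hom_mult[OF hom\<phi>, simplified]) (use xU gh in auto)
  then have 1: "\<phi> (g, h') = \<phi> (\<one>\<^bsub>G\<^esub>, x) \<otimes>\<^bsub>A\<^esub> \<phi> (g, h)" using c x by simp
  have "\<psi> ((x, \<one>\<^bsub>K\<^esub>) \<otimes>\<^bsub>H \<times>\<times> K\<^esub> (h, k)) = \<psi> (x, \<one>\<^bsub>K\<^esub>) \<otimes>\<^bsub>A\<^esub> \<psi> (h, k)"
    by (rule hom_mult[OF hom\<psi>, simplified]) (use xV hk in auto)
  then have 2: "\<psi> (h', k) = \<psi> (x, \<one>\<^bsub>K\<^esub>) \<otimes>\<^bsub>A\<^esub> \<psi> (h, k)" using c x by simp
  have "inv\<^bsub>A\<^esub> (\<phi> (\<one>\<^bsub>G\<^esub>, x)) = \<psi> (x, \<one>\<^bsub>K\<^esub>)"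
    using eq[of x] x xU xV by (simp add: k1_def k2_def char1_def char2_def)
  then have 3: "\<phi> (\<one>\<^bsub>G\<^esub>, x) \<otimes>\<^bsub>A\<^esub> \<psi> (x, \<one>\<^bsub>K\<^esub>) = \<one>\<^bsub>A\<^esub>"
    using car by (metis A.r_inv)
  have "\<phi> (g, h') \<otimes>\<^bsub>A\<^esub> \<psi> (h', k) =
      (\<phi> (\<one>\<^bsub>G\<^esub>, x) \<otimes>\<^bsub>A\<^esub> \<psi> (x, \<one>\<^bsub>K\<^esub>)) \<otimes>\<^bsub>A\<^esub> (\<phi> (g, h) \<otimes>\<^bsub>A\<^esub> \<psi> (h, k))"
    unfolding 1 2 using car by (simp add: A.m_ac)
  then show ?thesis
    using car 3 by (simp add: star_char_def Let_def h'_def)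
qed

definition double_cosets :: "('g, 'n) monoid_scheme \<Rightarrow> 'g set \<Rightarrow> 'g set \<Rightarrow> 'g set set"
  where "double_cosets G P Q = {(P #>\<^bsub>G\<^esub> x) <#>\<^bsub>G\<^esub> Q | x. x \<in> carrier G}"

definition double_coset_reps :: "('g, 'n) monoid_scheme \<Rightarrow> 'g set \<Rightarrow> 'g set \<Rightarrow> 'g set \<Rightarrow> bool"
  where "double_coset_reps G P Q R \<longleftrightarrow>
    R \<subseteq> carrier G \<and> (\<forall>D \<in> double_cosets G P Q. \<exists>!r. r \<in> R \<and> r \<in> D)"

text \<open>
  Sets with an action of a group with elements of type \<open>'p\<close>. As in \<^locale>\<open>group_action\<close>, the
  operators \<open>act X p\<close> are extensional on \<open>points X\<close>.
\<close>

record ('p, 'x) gset =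
  points :: "'x set"
  act :: "'p \<Rightarrow> 'x \<Rightarrow> 'x"

definition A_act :: "('g, 'n) monoid_scheme \<Rightarrow> ('h, 'o) monoid_scheme \<Rightarrow> ('a \<times> 'g \<times> 'h, 'x) gset \<Rightarrow> 'a \<Rightarrow> 'x \<Rightarrow> 'x"
  where "A_act G H X = (\<lambda>a. act X (a, \<one>\<^bsub>G\<^esub>, \<one>\<^bsub>H\<^esub>))"

definition fibered_biset ::
    "('a, 'm) monoid_scheme \<Rightarrow> ('g, 'n) monoid_scheme \<Rightarrow> ('h, 'o) monoid_scheme \<Rightarrow> ('a \<times> 'g \<times> 'h, 'x) gset \<Rightarrow> bool"
  where "fibered_biset A G H X \<longleftrightarrow>
    group_action (A \<times>\<times> G \<times>\<times> H) (points X) (act X) \<and>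
    (\<forall>x \<in> points X. stabilizer A (A_act G H X) x = {\<one>\<^bsub>A\<^esub>}) \<and>
    finite (orbits A (points X) (A_act G H X))"

definition fibered_biset_iso ::
    "('a, 'm) monoid_scheme \<Rightarrow> ('g, 'n) monoid_scheme \<Rightarrow> ('h, 'o) monoid_scheme \<Rightarrow>
     ('a \<times> 'g \<times> 'h, 'x) gset \<Rightarrow> ('a \<times> 'g \<times> 'h, 'y) gset \<Rightarrow> ('x \<Rightarrow> 'y) set"
  where "fibered_biset_iso A G H X Y =
    {f. fibered_biset A G H X \<and> fibered_biset A G H Y \<and>
        bij_betw f (points X) (points Y) \<and>
        (\<forall>p \<in> carrier (A \<times>\<times> G \<times>\<times> H). \<forall>x \<in> points X. f (act X p x) = act Y p (f x))}"

definition twist :: "('a, 'm) monoid_scheme \<Rightarrow> 'l set \<Rightarrow> ('l \<Rightarrow> 'a) \<Rightarrow> ('a \<times> 'l) set"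
  where "twist A U \<phi> = {(inv\<^bsub>A\<^esub> (\<phi> u), u) | u. u \<in> U}"

text \<open>
  In the next definition, \<open>L\<close> is to be a product \<open>G \<times>\<times> H\<close>. The trivial coset is the point
  \<open>twist A U \<phi>\<close> itself.
\<close>

definition coset_biset ::
    "('a, 'm) monoid_scheme \<Rightarrow> ('l, 'n) monoid_scheme \<Rightarrow> 'l set \<Rightarrow> ('l \<Rightarrow> 'a) \<Rightarrow> ('a \<times> 'l, ('a \<times> 'l) set) gset"
  where "coset_biset A L U \<phi> =
    \<lparr>points = lcosets\<^bsub>A \<times>\<times> L\<^esub> (twist A U \<phi>),
     act = (\<lambda>p. \<lambda>C \<in> lcosets\<^bsub>A \<times>\<times> L\<^esub> (twist A U \<phi>). p <#\<^bsub>A \<times>\<times> L\<^esub> C)\<rparr>"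

definition coprod_gset :: "'i set \<Rightarrow> ('i \<Rightarrow> ('p, 'x) gset) \<Rightarrow> ('p, 'i \<times> 'x) gset"
  where "coprod_gset I X =
    \<lparr>points = (SIGMA i:I. points (X i)),
     act = (\<lambda>p. \<lambda>(i, x) \<in> (SIGMA i:I. points (X i)). (i, act (X i) p x))\<rparr>"

definition pair_act ::
    "('a, 'm) monoid_scheme \<Rightarrow> ('g, 'n) monoid_scheme \<Rightarrow> ('h, 'o) monoid_scheme \<Rightarrow> ('k, 'q) monoid_scheme \<Rightarrow>
     ('a \<times> 'g \<times> 'h, 'x) gset \<Rightarrow> ('a \<times> 'h \<times> 'k, 'y) gset \<Rightarrow> 'a \<times> 'h \<Rightarrow> 'x \<times> 'y \<Rightarrow> 'x \<times> 'y"
  where "pair_act A G H K X Y = (\<lambda>(a, h). \<lambda>(x, y) \<in> points X \<times> points Y.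
    (act X (inv\<^bsub>A\<^esub> a, \<one>\<^bsub>G\<^esub>, h) x, act Y (a, h, \<one>\<^bsub>K\<^esub>) y))"

definition pair_class ::
    "('a, 'm) monoid_scheme \<Rightarrow> ('g, 'n) monoid_scheme \<Rightarrow> ('h, 'o) monoid_scheme \<Rightarrow> ('k, 'q) monoid_scheme \<Rightarrow>
     ('a \<times> 'g \<times> 'h, 'x) gset \<Rightarrow> ('a \<times> 'h \<times> 'k, 'y) gset \<Rightarrow> 'x \<Rightarrow> 'y \<Rightarrow> ('x \<times> 'y) set"
  where "pair_class A G H K X Y x y = orbit (A \<times>\<times> H) (pair_act A G H K X Y) (x, y)"

text \<open>
  The set of all classes \<open>[x, y]\<close>. The element \<open>(a, g, k)\<close> acts by taking images of orbits, which
  amounts to \<open>(a, g, k) [x, y] = [(a, g, 1) x, (1, 1, k) y]\<close>; see the lemma \<open>act_pair_class\<close>.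
\<close>

definition pair_classes ::
    "('a, 'm) monoid_scheme \<Rightarrow> ('g, 'n) monoid_scheme \<Rightarrow> ('h, 'o) monoid_scheme \<Rightarrow> ('k, 'q) monoid_scheme \<Rightarrow>
     ('a \<times> 'g \<times> 'h, 'x) gset \<Rightarrow> ('a \<times> 'h \<times> 'k, 'y) gset \<Rightarrow> ('a \<times> 'g \<times> 'k, ('x \<times> 'y) set) gset"
  where "pair_classes A G H K X Y =
    \<lparr>points = orbits (A \<times>\<times> H) (points X \<times> points Y) (pair_act A G H K X Y),
     act = (\<lambda>(a, g, k).
       \<lambda>C \<in> orbits (A \<times>\<times> H) (points X \<times> points Y) (pair_act A G H K X Y).
         (\<lambda>(x, y). (act X (a, g, \<one>\<^bsub>H\<^esub>) x, act Y (\<one>\<^bsub>A\<^esub>, \<one>\<^bsub>H\<^esub>, k) y)) ` C)\<rparr>"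

definition tensor ::
    "('a, 'm) monoid_scheme \<Rightarrow> ('g, 'n) monoid_scheme \<Rightarrow> ('h, 'o) monoid_scheme \<Rightarrow> ('k, 'q) monoid_scheme \<Rightarrow>
     ('a \<times> 'g \<times> 'h, 'x) gset \<Rightarrow> ('a \<times> 'h \<times> 'k, 'y) gset \<Rightarrow> ('a \<times> 'g \<times> 'k, ('x \<times> 'y) set) gset"
  where "tensor A G H K X Y =
    (let Z = pair_classes A G H K X Y;
         S = {C \<in> points Z. stabilizer A (A_act G K Z) C = {\<one>\<^bsub>A\<^esub>}}
     in \<lparr>points = S, act = (\<lambda>p. restrict (act Z p) S)\<rparr>)"

lemma act_pair_class:
  assumes "comm_group A" "group G" "group H" "group K"
    and X: "fibered_biset A G H X" and Y: "fibered_biset A H K Y"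
    and x: "x \<in> points X" and y: "y \<in> points Y"
    and a: "a \<in> carrier A" and g: "g \<in> carrier G" and k: "k \<in> carrier K"
  shows "act (pair_classes A G H K X Y) (a, g, k) (pair_class A G H K X Y x y) =
    pair_class A G H K X Y (act X (a, g, \<one>\<^bsub>H\<^esub>) x) (act Y (\<one>\<^bsub>A\<^esub>, \<one>\<^bsub>H\<^esub>, k) y)"
proof -
  interpret A: comm_group A by fact
  interpret G: group G by fact
  interpret H: group H by fact
  interpret K: group K by fact
  interpret X: group_action "A \<times>\<times> G \<times>\<times> H" "points X" "act X"
    using X by (simp add: fibered_biset_def)
  interpret Y: group_action "A \<times>\<times> H \<times>\<times> K" "points Y" "act Y"
    using Y by (simp add: fibered_biset_def)
  let ?T = "\<lambda>(x, y). (act X (a, g, \<one>\<^bsub>H\<^esub>) x, act Y (\<one>\<^bsub>A\<^esub>, \<one>\<^bsub>H\<^esub>, k) y)"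
  have x': "act X (a, g, \<one>\<^bsub>H\<^esub>) x \<in> points X"
    by (rule X.element_image[OF _ x refl]) (use a g in simp)
  have y': "act Y (\<one>\<^bsub>A\<^esub>, \<one>\<^bsub>H\<^esub>, k) y \<in> points Y"
    by (rule Y.element_image[OF _ y refl]) (use k in simp)
  have comm: "?T (pair_act A G H K X Y (b, h) (x, y)) = pair_act A G H K X Y (b, h) (?T (x, y))"
    if "b \<in> carrier A" "h \<in> carrier H" for b h
  proof -
    have "act X (a, g, \<one>\<^bsub>H\<^esub>) (act X (inv\<^bsub>A\<^esub> b, \<one>\<^bsub>G\<^esub>, h) x)
        = act X (inv\<^bsub>A\<^esub> b, \<one>\<^bsub>G\<^esub>, h) (act X (a, g, \<one>\<^bsub>H\<^esub>) x)"
      using that a g X.composition_rule[OF x, of "(a, g, \<one>\<^bsub>H\<^esub>)" "(inv\<^bsub>A\<^esub> b, \<one>\<^bsub>G\<^esub>, h)"]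
        X.composition_rule[OF x, of "(inv\<^bsub>A\<^esub> b, \<one>\<^bsub>G\<^esub>, h)" "(a, g, \<one>\<^bsub>H\<^esub>)"]
      by (simp add: A.m_comm)
    moreover have "act Y (\<one>\<^bsub>A\<^esub>, \<one>\<^bsub>H\<^esub>, k) (act Y (b, h, \<one>\<^bsub>K\<^esub>) y)
        = act Y (b, h, \<one>\<^bsub>K\<^esub>) (act Y (\<one>\<^bsub>A\<^esub>, \<one>\<^bsub>H\<^esub>, k) y)"
      using that k Y.composition_rule[OF y, of "(\<one>\<^bsub>A\<^esub>, \<one>\<^bsub>H\<^esub>, k)" "(b, h, \<one>\<^bsub>K\<^esub>)"]
        Y.composition_rule[OF y, of "(b, h, \<one>\<^bsub>K\<^esub>)" "(\<one>\<^bsub>A\<^esub>, \<one>\<^bsub>H\<^esub>, k)"]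
      by simp
    ultimately show ?thesis using x y x' y' by (simp add: pair_act_def)
  qed
  have "?T ` orbit (A \<times>\<times> H) (pair_act A G H K X Y) (x, y) =
      orbit (A \<times>\<times> H) (pair_act A G H K X Y) (?T (x, y))"
  proof -
    have "?T ` orbit (A \<times>\<times> H) (pair_act A G H K X Y) (x, y)
        = (\<lambda>p. ?T (pair_act A G H K X Y p (x, y))) ` carrier (A \<times>\<times> H)"
      unfolding orbit_def by blast
    also have "\<dots> = (\<lambda>p. pair_act A G H K X Y p (?T (x, y))) ` carrier (A \<times>\<times> H)"
      by (rule image_cong[OF refl], unfold carrier_DirProd, erule SigmaE, simp only: comm)
    also have "\<dots> = orbit (A \<times>\<times> H) (pair_act A G H K X Y) (?T (x, y))"
      unfolding orbit_def by blast
    finally show ?thesis .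
  qed
  moreover have "orbit (A \<times>\<times> H) (pair_act A G H K X Y) (x, y) \<in>
      orbits (A \<times>\<times> H) (points X \<times> points Y) (pair_act A G H K X Y)"
    unfolding orbits_def using x y by blast
  ultimately show ?thesis
    by (simp add: pair_classes_def pair_class_def)
qed

end

theory Submission
  imports Defs
begin

text \<open>
Let \<open>X = (G \<times> H) / (U, \<phi>)\<close>, \<open>Y = (H \<times> K) / (V, \<psi>)\<close> and, for \<open>t \<in> H\<close>, let \<open>z\<^sub>t\<close> be the class of
\<open>(U\<^sub>\<phi>, (1, t, 1) V\<^sub>\<psi>)\<close>. The formula is the orbit-stabilizer theorem for \<open>A \<times> G \<times> K\<close> acting on the
tensor product: the \<open>z\<^sub>t\<close>, for the admissible representatives \<open>t\<close>, form a system of representatives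
of the orbits, and the stabilizer of \<open>z\<^sub>t\<close> is exactly the twisted subgroup by which the
\<open>t\<close>-component on the right is defined (lemma \<open>orbit_decomposition\<close>).

Everything about the \<open>z\<^sub>t\<close> follows from one computation, lemma \<open>act_base_class_eq_iff\<close>:
\<open>(a, g, k) z\<^sub>s = z\<^sub>t\<close> holds iff some \<open>h\<close> satisfies \<open>(g, h) \<in> U\<close>, \<open>(t\<inverse> h s, k) \<in> V\<close> and
\<open>a = (\<phi> (g, h) \<psi> (t\<inverse> h s, k))\<inverse>\<close>. Three readings of this condition are used.

  \<^item> Such \<open>(g, h)\<close> and \<open>(t\<inverse> h s, k)\<close> exist for some \<open>g\<close>, \<open>k\<close> iff \<open>s\<close> and \<open>t\<close> lie in the same double
    coset of \<open>p\<^sub>2 U\<close> and \<open>p\<^sub>1 V\<close>. As each class is a translate of some \<open>z\<^sub>s\<close>, the orbits on the set of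
    all classes correspond to these double cosets (\<open>Z_points_eq_act_base_class\<close>,
    \<open>base_class_orbits_distinct\<close>).

  \<^item> For \<open>s = t\<close>, \<open>g = 1\<close>, \<open>k = 1\<close> the element \<open>h\<close> runs through \<open>H\<^sub>t\<close>, and the stabilizer in \<open>A\<close>
    is trivial iff \<open>\<phi>\<^sub>2\<close> and the conjugate of \<open>\<psi>\<^sub>1\<close> agree on \<open>H\<^sub>t\<close>. So this is the condition for
    \<open>z\<^sub>t\<close> to lie in the tensor product (\<open>base_class_in_L_iff\<close>).

  \<^item> For \<open>s = t\<close> the whole condition describes the stabilizer of \<open>z\<^sub>t\<close>: the pairs \<open>(g, k)\<close> are those
    of the product of \<open>U\<close> with the conjugate of \<open>V\<close>, and \<open>a\<close> is the inverse of the product character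
    (\<open>stabilizer_base_class\<close>).

That the tensor product is a fibered biset is checked directly; for the coproduct it then follows by
transport along the bijection (\<open>fibered_biset_transport\<close>).
\<close>

section \<open>Group actions and their orbits\<close>

text \<open>
Invertibility of the operators comes for free from the action of inverses, so it suffices to check
the two axioms of an action on points, besides extensionality.
\<close>

lemma group_actionI:
  assumes "group G"
    and closed: "\<And>p x. p \<in> carrier G \<Longrightarrow> x \<in> E \<Longrightarrow> \<phi> p x \<in> E"
    and ext: "\<And>p. p \<in> carrier G \<Longrightarrow> \<phi> p \<in> extensional E"
    and one: "\<And>x. x \<in> E \<Longrightarrow> \<phi> \<one>\<^bsub>G\<^esub> x = x"
    and mult: "\<And>p q x. p \<in> carrier G \<Longrightarrow> q \<in> carrier G \<Longrightarrow> x \<in> E \<Longrightarrow> \<phi> (p \<otimes>\<^bsub>G\<^esub> q) x = \<phi> p (\<phi> q x)"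
  shows "group_action G E \<phi>"
proof -
  interpret G: group G by fact
  have bij: "\<phi> p \<in> Bij E" if p: "p \<in> carrier G" for p
  proof -
    have "\<phi> (inv\<^bsub>G\<^esub> p) (\<phi> p x) = x" "\<phi> p (\<phi> (inv\<^bsub>G\<^esub> p) x) = x" if "x \<in> E" for x
      using mult[of "inv\<^bsub>G\<^esub> p" p x] mult[of p "inv\<^bsub>G\<^esub> p" x] one[OF that] p that by simp_all
    then have "bij_betw (\<phi> p) E E"
      by (intro bij_betwI[where g = "\<phi> (inv\<^bsub>G\<^esub> p)"]) (use p closed in auto)
    then show ?thesis using ext[OF p] by (simp add: Bij_def)
  qed
  have "\<phi> (p \<otimes>\<^bsub>G\<^esub> q) = compose E (\<phi> p) (\<phi> q)" if "p \<in> carrier G" "q \<in> carrier G" for p q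
    using that ext[of "p \<otimes>\<^bsub>G\<^esub> q"]
    by (intro extensionalityI[of _ E]) (auto simp: compose_eq mult)
  then have "\<phi> \<in> hom G (BijGroup E)"
    using bij by (intro homI) (auto simp: BijGroup_def)
  then show ?thesis
    by (simp add: group_action_def group_hom_def group_hom_axioms_def group_BijGroup \<open>group G\<close>)
qed

lemma (in group) l_coset_eq_iff:
  assumes "subgroup S G" "x \<in> carrier G" "y \<in> carrier G"
  shows "x <# S = y <# S \<longleftrightarrow> inv y \<otimes> x \<in> S"
proof
  assume "x <# S = y <# S"
  then have "x \<in> y <# S" using lcos_self[OF assms(2,1)] by simp
  then show "inv y \<otimes> x \<in> S"
    by (rule subgroup.lcos_module_imp[OF assms(1) is_group assms(3)])
next
  assume "inv y \<otimes> x \<in> S"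
  then have "x \<in> y <# S"
    by (rule subgroup.lcos_module_rev[OF assms(1) is_group assms(3,2)])
  then show "x <# S = y <# S"
    using l_repr_independence[OF _ assms(3,1)] by simp
qed

text \<open>
This is what makes the inverse of \<open>p S \<mapsto> p x\<close>, for \<open>S\<close> the stabilizer of \<open>x\<close>, available without a
choice: a point of the orbit of \<open>x\<close> is sent to the set of all elements that carry \<open>x\<close> to it.
\<close>

lemma (in group_action) transporter_eq_l_coset:
  assumes x: "x \<in> E" and q: "q \<in> carrier G"
  shows "{p \<in> carrier G. \<phi> p x = \<phi> q x} = q <# stabilizer G \<phi> x"
proof -
  interpret G: group G using group_hom group_hom.axioms(1) by auto
  have "p \<in> q <# stabilizer G \<phi> x" if p: "p \<in> carrier G" "\<phi> p x = \<phi> q x" for p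
  proof -
    have "\<phi> (inv q \<otimes> p) x = x"
      using p q x composition_rule[of x "inv q" p] orbit_sym_aux[of q x "\<phi> q x"] by simp
    then have "inv q \<otimes> p \<in> stabilizer G \<phi> x" using p q by (simp add: stabilizer_def)
    moreover have "p = q \<otimes> (inv q \<otimes> p)" using p q by (simp add: G.m_assoc[symmetric])
    ultimately show ?thesis unfolding l_coset_def by blast
  qed
  then show ?thesis
    using x q by (auto simp: l_coset_def stabilizer_def composition_rule)
qed

text \<open>
Orbit-stabilizer theorem for several orbits at once, as an isomorphism of \<open>G\<close>-sets: once a
representative of each orbit is chosen, a \<open>G\<close>-set is the coproduct of the coset spaces of their
stabilizers. The map sends \<open>x\<close> to its representative together with the transporter from that
representative to \<open>x\<close>.
\<close>

lemma (in group_action) orbit_decomposition: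
  assumes z: "\<And>t. t \<in> T \<Longrightarrow> z t \<in> E"
    and distinct: "\<And>s t p. s \<in> T \<Longrightarrow> t \<in> T \<Longrightarrow> p \<in> carrier G \<Longrightarrow> \<phi> p (z s) = z t \<Longrightarrow> s = t"
    and cover: "\<And>x. x \<in> E \<Longrightarrow> \<exists>t \<in> T. \<exists>p \<in> carrier G. \<phi> p (z t) = x"
  obtains f where "bij_betw f E (SIGMA t:T. lcosets (stabilizer G \<phi> (z t)))"
    and "\<And>p x. p \<in> carrier G \<Longrightarrow> x \<in> E \<Longrightarrow> f (\<phi> p x) = (fst (f x), p <# snd (f x))"
    and "\<And>t. t \<in> T \<Longrightarrow> f (z t) = (t, stabilizer G \<phi> (z t))"
proof -
  interpret G: group G using group_hom group_hom.axioms(1) by auto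
  define rep where "rep x = (THE t. t \<in> T \<and> (\<exists>p \<in> carrier G. \<phi> p (z t) = x))" for x
  define f where "f x = (rep x, {p \<in> carrier G. \<phi> p (z (rep x)) = x})" for x
  have rep_eq: "rep (\<phi> p (z t)) = t" if t: "t \<in> T" and p: "p \<in> carrier G" for t p
    unfolding rep_def
  proof (rule the_equality)
    show "t \<in> T \<and> (\<exists>q\<in>carrier G. \<phi> q (z t) = \<phi> p (z t))" using t p by blast
  next
    fix s assume "s \<in> T \<and> (\<exists>q\<in>carrier G. \<phi> q (z s) = \<phi> p (z t))"
    then obtain q where s: "s \<in> T" and q: "q \<in> carrier G" "\<phi> q (z s) = \<phi> p (z t)" by blast
    have "\<phi> (inv p \<otimes> q) (z s) = z t"
      using s t p q z composition_rule[of "z s" "inv p" q] orbit_sym_aux[of p "z t"] by simp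
    then show "s = t" using distinct[of s t "inv p \<otimes> q"] s t p q by simp
  qed
  have f_eq: "f (\<phi> p (z t)) = (t, p <# stabilizer G \<phi> (z t))" if "t \<in> T" "p \<in> carrier G" for t p
    using that z transporter_eq_l_coset by (simp add: f_def rep_eq)
  show thesis
  proof (rule that[of f])
    have "inj_on f E"
    proof (rule inj_onI)
      fix x y assume x: "x \<in> E" and y: "y \<in> E" and eq: "f x = f y"
      obtain t p where tp: "t \<in> T" "p \<in> carrier G" "\<phi> p (z t) = x" using cover[OF x] by blast
      have "rep x = t" using tp rep_eq by blast
      then have "p \<in> snd (f x)" using tp by (simp add: f_def)
      then have "p \<in> snd (f y)" using eq by simp
      then have "\<phi> p (z (rep y)) = y" by (simp add: f_def)
      then show "x = y" using tp \<open>rep x = t\<close> eq by (simp add: f_def)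
    qed
    moreover have "f ` E = (SIGMA t:T. lcosets (stabilizer G \<phi> (z t)))"
    proof
      show "f ` E \<subseteq> (SIGMA t:T. lcosets (stabilizer G \<phi> (z t)))"
      proof
        fix c assume "c \<in> f ` E"
        then obtain x where x: "x \<in> E" "c = f x" by blast
        obtain t p where "t \<in> T" "p \<in> carrier G" "\<phi> p (z t) = x" using cover[OF x(1)] by blast
        then show "c \<in> (SIGMA t:T. lcosets (stabilizer G \<phi> (z t)))"
          using x f_eq[of t p] by (auto simp: LCOSETS_def)
      qed
    next
      show "(SIGMA t:T. lcosets (stabilizer G \<phi> (z t))) \<subseteq> f ` E"
      proof
        fix c assume "c \<in> (SIGMA t:T. lcosets (stabilizer G \<phi> (z t)))"
        then obtain t p where t: "t \<in> T" and p: "p \<in> carrier G"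
          and c: "c = (t, p <# stabilizer G \<phi> (z t))"
          by (auto simp: LCOSETS_def)
        have "c = f (\<phi> p (z t))" using f_eq[OF t p] c by simp
        then show "c \<in> f ` E" using element_image[OF p z[OF t] refl] by blast
      qed
    qed
    ultimately show "bij_betw f E (SIGMA t:T. lcosets (stabilizer G \<phi> (z t)))"
      by (simp add: bij_betw_def)
  next
    fix p x assume p: "p \<in> carrier G" and x: "x \<in> E"
    obtain t q where q: "t \<in> T" "q \<in> carrier G" "\<phi> q (z t) = x" using cover[OF x] by blast
    have "\<phi> p x = \<phi> (p \<otimes> q) (z t)" using p q z composition_rule by simp
    moreover have "(p \<otimes> q) <# stabilizer G \<phi> (z t) = p <# (q <# stabilizer G \<phi> (z t))"
      using p q stabilizer_subset by (simp add: G.lcos_m_assoc)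
    ultimately show "f (\<phi> p x) = (fst (f x), p <# snd (f x))"
      using f_eq[of t "p \<otimes> q"] f_eq[of t q] p q by simp
  next
    fix t assume t: "t \<in> T"
    have "\<phi> \<one> (z t) = z t" using z[OF t] id_eq_one by (metis restrict_apply')
    then show "f (z t) = (t, stabilizer G \<phi> (z t))"
      using f_eq[OF t G.one_closed] stabilizer_subset by (simp add: G.lcos_mult_one)
  qed
qed

section \<open>Transport of fibered bisets\<close>

text \<open>
Equations between points, stabilizers and \<open>A\<close>-orbits correspond under an equivariant bijection.
Only extensionality, a convention on the operators outside the set of points, cannot be read off
from \<open>f\<close> and has to be assumed.
\<close>

lemma fibered_biset_transport:
  assumes "comm_group A" "group G" "group H"
    and X: "fibered_biset A G H X" and f: "bij_betw f (points X) (points Y)"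
    and ext: "\<And>p. p \<in> carrier (A \<times>\<times> G \<times>\<times> H) \<Longrightarrow> act Y p \<in> extensional (points Y)"
    and equiv: "\<And>p x. p \<in> carrier (A \<times>\<times> G \<times>\<times> H) \<Longrightarrow> x \<in> points X \<Longrightarrow> f (act X p x) = act Y p (f x)"
  shows "fibered_biset A G H Y"
proof -
  interpret A: comm_group A by fact
  interpret G: group G by fact
  interpret H: group H by fact
  interpret AGH: group "A \<times>\<times> G \<times>\<times> H" by (intro DirProd_group) unfold_locales
  interpret X: group_action "A \<times>\<times> G \<times>\<times> H" "points X" "act X"
    using X by (simp add: fibered_biset_def)
  have Y: "points Y = f ` points X" using f by (simp add: bij_betw_def)
  have inj: "f x = f y \<longleftrightarrow> x = y" if "x \<in> points X" "y \<in> points X" for x y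
    using f that by (auto simp: bij_betw_def inj_on_def)
  have closed: "act X p x \<in> points X" if "p \<in> carrier (A \<times>\<times> G \<times>\<times> H)" "x \<in> points X" for p x
    using X.element_image[OF that refl] .
  have "group_action (A \<times>\<times> G \<times>\<times> H) (points Y) (act Y)"
  proof (rule group_actionI[OF AGH.is_group _ ext])
    fix x assume "x \<in> points Y"
    then show "act Y \<one>\<^bsub>A \<times>\<times> G \<times>\<times> H\<^esub> x = x"
      unfolding Y using X.id_eq_one[symmetric] equiv[OF AGH.one_closed, symmetric] by auto
  next
    fix p q y assume pq: "p \<in> carrier (A \<times>\<times> G \<times>\<times> H)" "q \<in> carrier (A \<times>\<times> G \<times>\<times> H)"
      and "y \<in> points Y"
    then obtain x where x: "x \<in> points X" "y = f x" unfolding Y by blast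
    have "f (act X (p \<otimes>\<^bsub>A \<times>\<times> G \<times>\<times> H\<^esub> q) x) = f (act X p (act X q x))"
      using X.composition_rule[OF x(1) pq] by simp
    then show "act Y (p \<otimes>\<^bsub>A \<times>\<times> G \<times>\<times> H\<^esub> q) y = act Y p (act Y q y)"
      unfolding x(2) equiv[OF AGH.m_closed[OF pq] x(1)] equiv[OF pq(1) closed[OF pq(2) x(1)]]
        equiv[OF pq(2) x(1)] .
  qed (auto simp: Y closed equiv[symmetric] simp del: carrier_DirProd)
  moreover have a: "(a, \<one>\<^bsub>G\<^esub>, \<one>\<^bsub>H\<^esub>) \<in> carrier (A \<times>\<times> G \<times>\<times> H)" if "a \<in> carrier A" for a
    using that by simp
  have "stabilizer A (A_act G H Y) (f x) = stabilizer A (A_act G H X) x" if "x \<in> points X" for x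
    using that a closed by (auto simp: stabilizer_def A_act_def equiv[symmetric] inj)
  then have "\<forall>y \<in> points Y. stabilizer A (A_act G H Y) y = {\<one>\<^bsub>A\<^esub>}"
    using X by (auto simp: Y fibered_biset_def)
  moreover have "orbit A (A_act G H Y) (f x) = f ` orbit A (A_act G H X) x" if "x \<in> points X" for x
    using that a by (force simp: orbit_def A_act_def equiv[symmetric])
  then have "orbits A (points Y) (A_act G H Y) = (\<lambda>C. f ` C) ` orbits A (points X) (A_act G H X)"
    by (auto simp: orbits_def Y image_iff)
  then have "finite (orbits A (points Y) (A_act G H Y))"
    using X by (simp add: fibered_biset_def)
  ultimately show ?thesis by (simp add: fibered_biset_def)
qed

section \<open>Twisted subgroups and their coset bisets\<close>

lemma char_pairsD:
  assumes "(U, \<phi>) \<in> char_pairs A L"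
  shows "subgroup U L" and "\<And>u. u \<in> U \<Longrightarrow> \<phi> u \<in> carrier A"
    and "\<And>u v. u \<in> U \<Longrightarrow> v \<in> U \<Longrightarrow> \<phi> (u \<otimes>\<^bsub>L\<^esub> v) = \<phi> u \<otimes>\<^bsub>A\<^esub> \<phi> v"
  using assms by (auto simp: char_pairs_def hom_def)

lemma char_pairs_one:
  assumes "group A" "group L" "(U, \<phi>) \<in> char_pairs A L"
  shows "\<phi> \<one>\<^bsub>L\<^esub> = \<one>\<^bsub>A\<^esub>"
proof -
  interpret L: group L by fact
  have "group (L\<lparr>carrier := U\<rparr>)"
    using char_pairsD(1)[OF assms(3)] L.subgroup_imp_group by blast
  then show ?thesis
    using hom_one[of \<phi> "L\<lparr>carrier := U\<rparr>" A] assms by (simp add: char_pairs_def)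
qed

lemma mem_twist_iff: "(a, u) \<in> twist A U \<phi> \<longleftrightarrow> u \<in> U \<and> a = inv\<^bsub>A\<^esub> (\<phi> u)"
  by (auto simp: twist_def)

text \<open>
The twist is the graph of \<open>u \<mapsto> (\<phi> u)\<inverse>\<close>, which is a homomorphism because \<open>A\<close> is abelian.
\<close>

lemma subgroup_twist:
  assumes "comm_group A" "group L" and \<phi>: "(U, \<phi>) \<in> char_pairs A L"
  shows "subgroup (twist A U \<phi>) (A \<times>\<times> L)"
proof -
  interpret A: comm_group A by fact
  interpret L: group L by fact
  interpret AL: group "A \<times>\<times> L" by (intro DirProd_group) unfold_locales
  interpret U: subgroup U L using char_pairsD(1)[OF \<phi>] .
  note car = char_pairsD(2)[OF \<phi>] and mult = char_pairsD(3)[OF \<phi>]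
  have one: "\<phi> \<one>\<^bsub>L\<^esub> = \<one>\<^bsub>A\<^esub>" using char_pairs_one[OF _ _ \<phi>] A.is_group L.is_group by blast
  show ?thesis
  proof (rule AL.subgroupI)
    show "twist A U \<phi> \<subseteq> carrier (A \<times>\<times> L)" using car U.subset by (auto simp: twist_def)
    have "(inv\<^bsub>A\<^esub> (\<phi> \<one>\<^bsub>L\<^esub>), \<one>\<^bsub>L\<^esub>) \<in> twist A U \<phi>" by (simp add: mem_twist_iff)
    then show "twist A U \<phi> \<noteq> {}" by blast
  next
    fix p assume "p \<in> twist A U \<phi>"
    then obtain u where u: "u \<in> U" "p = (inv\<^bsub>A\<^esub> (\<phi> u), u)" by (auto simp: twist_def)
    have "\<phi> (inv\<^bsub>L\<^esub> u) \<otimes>\<^bsub>A\<^esub> \<phi> u = \<one>\<^bsub>A\<^esub>" using u one mult[of "inv\<^bsub>L\<^esub> u" u] by simp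
    then have "inv\<^bsub>A\<^esub> (\<phi> u) = \<phi> (inv\<^bsub>L\<^esub> u)"
      using u car by (intro A.inv_equality) auto
    then show "inv\<^bsub>A \<times>\<times> L\<^esub> p \<in> twist A U \<phi>"
      using u car A.is_group L.is_group by (simp add: inv_DirProd mem_twist_iff)
  next
    fix p q assume "p \<in> twist A U \<phi>" "q \<in> twist A U \<phi>"
    then show "p \<otimes>\<^bsub>A \<times>\<times> L\<^esub> q \<in> twist A U \<phi>"
      using car by (auto simp: twist_def mult A.inv_mult)
  qed
qed

text \<open>
The twist meets \<open>A\<close> trivially since \<open>\<phi>\<close> maps \<open>1\<close> to \<open>1\<close>, and \<open>A\<close> is central; hence \<open>A\<close> acts freely.
As \<open>A\<close> sweeps out the first coordinate, an \<open>A\<close>-orbit is determined by an element of the finite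
group \<open>G \<times> H\<close>.
\<close>

lemma fibered_biset_coset_biset:
  assumes "comm_group A" "group G" "finite (carrier G)" "group H" "finite (carrier H)"
    and \<phi>: "(U, \<phi>) \<in> char_pairs A (G \<times>\<times> H)"
  shows "fibered_biset A G H (coset_biset A (G \<times>\<times> H) U \<phi>)"
proof -
  interpret A: comm_group A by fact
  interpret G: group G by fact
  interpret H: group H by fact
  interpret GH: group "G \<times>\<times> H" by (intro DirProd_group) unfold_locales
  let ?P = "A \<times>\<times> G \<times>\<times> H"
  interpret P: group ?P by (intro DirProd_group) unfold_locales
  define S where "S = twist A U \<phi>"
  define X where "X = coset_biset A (G \<times>\<times> H) U \<phi>"
  interpret S: subgroup S ?P unfolding S_def using subgroup_twist[OF assms(1) GH.is_group \<phi>] .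
  have pts: "points X = lcosets\<^bsub>?P\<^esub> S"
    and act: "act X p C = (if C \<in> points X then p <#\<^bsub>?P\<^esub> C else undefined)" for p C
    by (simp_all add: X_def S_def coset_biset_def)
  have closed: "p <#\<^bsub>?P\<^esub> (q <#\<^bsub>?P\<^esub> S) = (p \<otimes>\<^bsub>?P\<^esub> q) <#\<^bsub>?P\<^esub> S"
    if "p \<in> carrier ?P" "q \<in> carrier ?P" for p q
    using that S.subset by (rule P.lcos_m_assoc[rotated])
  have ptsE: "\<exists>q \<in> carrier ?P. C = q <#\<^bsub>?P\<^esub> S" if "C \<in> points X" for C
    using that by (auto simp: pts LCOSETS_def)
  have ptsI: "q <#\<^bsub>?P\<^esub> S \<in> points X" if "q \<in> carrier ?P" for q
    using that by (auto simp: pts LCOSETS_def)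
  have act_coset: "act X p (q <#\<^bsub>?P\<^esub> S) = (p \<otimes>\<^bsub>?P\<^esub> q) <#\<^bsub>?P\<^esub> S"
    if "p \<in> carrier ?P" "q \<in> carrier ?P" for p q
    using that by (simp add: act ptsI closed del: carrier_DirProd)
  have "group_action ?P (points X) (act X)"
  proof (rule group_actionI[OF P.is_group])
    fix p C assume "p \<in> carrier ?P" "C \<in> points X"
    then show "act X p C \<in> points X"
      using ptsE[of C] by (auto simp: act_coset simp del: carrier_DirProd mult_DirProd intro!: ptsI P.m_closed)
  next
    fix p q C assume "p \<in> carrier ?P" "q \<in> carrier ?P" "C \<in> points X"
    then show "act X (p \<otimes>\<^bsub>?P\<^esub> q) C = act X p (act X q C)"
      using ptsE[of C] P.m_closed by (auto simp: act_coset P.m_assoc simp del: carrier_DirProd mult_DirProd)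
  next
    fix C assume "C \<in> points X"
    then show "act X \<one>\<^bsub>?P\<^esub> C = C"
      using ptsE[of C] by (auto simp: act_coset simp del: carrier_DirProd mult_DirProd one_DirProd)
  qed (auto simp: act extensional_def)
  moreover have "stabilizer A (A_act G H X) C = {\<one>\<^bsub>A\<^esub>}" if C: "C \<in> points X" for C
  proof -
    obtain b g h where q: "b \<in> carrier A" "g \<in> carrier G" "h \<in> carrier H"
      and C: "C = (b, g, h) <#\<^bsub>?P\<^esub> S" using ptsE[OF C] by auto
    have one: "\<phi> (\<one>\<^bsub>G\<^esub>, \<one>\<^bsub>H\<^esub>) = \<one>\<^bsub>A\<^esub>"
      using char_pairs_one[OF _ _ \<phi>] A.is_group GH.is_group by simp
    have "A_act G H X a C = C \<longleftrightarrow> a = \<one>\<^bsub>A\<^esub>" if a: "a \<in> carrier A" for a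
    proof -
      have "A_act G H X a C = (a \<otimes>\<^bsub>A\<^esub> b, g, h) <#\<^bsub>?P\<^esub> S"
        using a q by (simp add: A_act_def C act_coset)
      also have "\<dots> = C \<longleftrightarrow> inv\<^bsub>?P\<^esub> (b, g, h) \<otimes>\<^bsub>?P\<^esub> (a \<otimes>\<^bsub>A\<^esub> b, g, h) \<in> S"
        unfolding C by (rule P.l_coset_eq_iff) (use a q S.subgroup_axioms in auto)
      also have "inv\<^bsub>?P\<^esub> (b, g, h) \<otimes>\<^bsub>?P\<^esub> (a \<otimes>\<^bsub>A\<^esub> b, g, h) = (a, \<one>\<^bsub>G\<^esub>, \<one>\<^bsub>H\<^esub>)"
      proof -
        have "inv\<^bsub>A\<^esub> b \<otimes>\<^bsub>A\<^esub> (a \<otimes>\<^bsub>A\<^esub> b) = a"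
          using a q by (simp add: A.m_comm[of a b] A.m_assoc[symmetric])
        then show ?thesis
          using a q by (simp add: inv_DirProd A.is_group G.is_group H.is_group GH.is_group)
      qed
      also have "\<dots> \<in> S \<longleftrightarrow> a = \<one>\<^bsub>A\<^esub>"
        using S.one_closed by (auto simp: S_def mem_twist_iff one)
      finally show ?thesis .
    qed
    then show ?thesis by (auto simp: stabilizer_def)
  qed
  moreover have "finite (orbits A (points X) (A_act G H X))"
  proof -
    have "orbits A (points X) (A_act G H X) \<subseteq>
        (\<lambda>l. {(a, l) <#\<^bsub>?P\<^esub> S | a. a \<in> carrier A}) ` carrier (G \<times>\<times> H)"
    proof
      fix Z assume "Z \<in> orbits A (points X) (A_act G H X)"
      then obtain C where C: "C \<in> points X" "Z = orbit A (A_act G H X) C" by (auto simp: orbits_def)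
      obtain b g h where q: "b \<in> carrier A" "g \<in> carrier G" "h \<in> carrier H"
        and Cq: "C = (b, g, h) <#\<^bsub>?P\<^esub> S" using ptsE[OF C(1)] by auto
      have ac: "A_act G H X a C = (a \<otimes>\<^bsub>A\<^esub> b, g, h) <#\<^bsub>?P\<^esub> S" if "a \<in> carrier A" for a
        using that q by (simp add: A_act_def Cq act_coset)
      have "Z = {(a, g, h) <#\<^bsub>?P\<^esub> S | a. a \<in> carrier A}"
      proof
        show "Z \<subseteq> {(a, g, h) <#\<^bsub>?P\<^esub> S | a. a \<in> carrier A}"
          unfolding C(2) orbit_def using ac q by blast
      next
        show "{(a, g, h) <#\<^bsub>?P\<^esub> S | a. a \<in> carrier A} \<subseteq> Z"
        proof clarify
          fix a assume a: "a \<in> carrier A"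
          have "(a, g, h) <#\<^bsub>?P\<^esub> S = A_act G H X (a \<otimes>\<^bsub>A\<^esub> inv\<^bsub>A\<^esub> b) C"
            using a q ac by (simp add: A.m_assoc)
          then show "(a, g, h) <#\<^bsub>?P\<^esub> S \<in> Z"
            unfolding C(2) orbit_def using a q by blast
        qed
      qed
      then show "Z \<in> (\<lambda>l. {(a, l) <#\<^bsub>?P\<^esub> S | a. a \<in> carrier A}) ` carrier (G \<times>\<times> H)"
        using q by auto
    qed
    then show ?thesis by (rule finite_subset) (simp add: assms)
  qed
  ultimately show ?thesis by (simp add: fibered_biset_def X_def)
qed

section \<open>Conjugate subgroups and characters\<close>

lemma (in group) mem_conj_set_iff:
  assumes g: "g \<in> carrier G" and U: "U \<subseteq> carrier G"
  shows "y \<in> conj_set G g U \<longleftrightarrow> y \<in> carrier G \<and> inv g \<otimes> y \<otimes> g \<in> U"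
proof
  assume "y \<in> conj_set G g U"
  then obtain u where u: "u \<in> U" "y = g \<otimes> u \<otimes> inv g"
    by (auto simp: conj_set_def l_coset_def r_coset_def)
  then have "inv g \<otimes> y \<otimes> g = u"
    using g U conjugation_is_surj[of "inv g" u] by auto
  then show "y \<in> carrier G \<and> inv g \<otimes> y \<otimes> g \<in> U" using u g U by auto
next
  assume y: "y \<in> carrier G \<and> inv g \<otimes> y \<otimes> g \<in> U"
  then have "y = g \<otimes> (inv g \<otimes> y \<otimes> g) \<otimes> inv g"
    using g conjugation_is_surj[of g y] by simp
  then show "y \<in> conj_set G g U"
    using y unfolding conj_set_def l_coset_def r_coset_def by blast
qed

lemma conj_char_pairs:
  assumes "group L" and g: "g \<in> carrier L" and \<phi>: "(U, \<phi>) \<in> char_pairs A L"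
  shows "(conj_set L g U, conj_char L g \<phi>) \<in> char_pairs A L"
proof -
  interpret L: group L by fact
  interpret U: subgroup U L using char_pairsD(1)[OF \<phi>] .
  note mem = L.mem_conj_set_iff[OF g U.subset]
  define c where "c y = inv\<^bsub>L\<^esub> g \<otimes>\<^bsub>L\<^esub> y \<otimes>\<^bsub>L\<^esub> g" for y
  have c_mult: "c (x \<otimes>\<^bsub>L\<^esub> y) = c x \<otimes>\<^bsub>L\<^esub> c y" if "x \<in> carrier L" "y \<in> carrier L" for x y
  proof -
    have "g \<otimes>\<^bsub>L\<^esub> (inv\<^bsub>L\<^esub> g \<otimes>\<^bsub>L\<^esub> (y \<otimes>\<^bsub>L\<^esub> g)) = y \<otimes>\<^bsub>L\<^esub> g"
      using that g L.m_assoc[of g "inv\<^bsub>L\<^esub> g" "y \<otimes>\<^bsub>L\<^esub> g"] by simp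
    then show ?thesis using that g by (simp add: c_def L.m_assoc)
  qed
  have c_inv: "c (inv\<^bsub>L\<^esub> y) = inv\<^bsub>L\<^esub> (c y)" if "y \<in> carrier L" for y
    using that g by (simp add: c_def L.inv_mult_group L.m_assoc)
  have mem': "y \<in> conj_set L g U \<longleftrightarrow> y \<in> carrier L \<and> c y \<in> U" for y
    unfolding mem c_def ..
  have "subgroup (conj_set L g U) L"
  proof (rule L.subgroupI)
    have "\<one>\<^bsub>L\<^esub> \<in> conj_set L g U" unfolding mem using g by simp
    then show "conj_set L g U \<noteq> {}" by blast
  qed (auto simp: mem' c_mult c_inv)
  moreover have "conj_char L g \<phi> \<in> hom (L\<lparr>carrier := conj_set L g U\<rparr>) A"
    using char_pairsD(2,3)[OF \<phi>]
    by (intro homI) (auto simp: conj_char_def mem' c_mult c_def[symmetric])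
  ultimately show ?thesis by (simp add: char_pairs_def)
qed

section \<open>The tensor product as a fibered biset\<close>

locale fibered_biset_pair =
  A: comm_group A + G: group G + H: group H + K: group K
  for A :: "('a, 'm) monoid_scheme" and G :: "('g, 'n) monoid_scheme"
    and H :: "('h, 'o) monoid_scheme" and K :: "('k, 'q) monoid_scheme" +
  fixes X :: "('a \<times> 'g \<times> 'h, 'x) gset" and Y :: "('a \<times> 'h \<times> 'k, 'y) gset"
  assumes X: "fibered_biset A G H X" and Y: "fibered_biset A H K Y"
begin

sublocale X: group_action "A \<times>\<times> G \<times>\<times> H" "points X" "act X"
  using X by (simp add: fibered_biset_def)

sublocale Y: group_action "A \<times>\<times> H \<times>\<times> K" "points Y" "act Y"
  using Y by (simp add: fibered_biset_def)

abbreviation cls where "cls \<equiv> pair_class A G H K X Y"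
abbreviation Z where "Z \<equiv> pair_classes A G H K X Y"
abbreviation L where "L \<equiv> tensor A G H K X Y"

lemma X_closed: "p \<in> carrier (A \<times>\<times> G \<times>\<times> H) \<Longrightarrow> x \<in> points X \<Longrightarrow> act X p x \<in> points X"
  using X.element_image by blast

lemma Y_closed: "p \<in> carrier (A \<times>\<times> H \<times>\<times> K) \<Longrightarrow> y \<in> points Y \<Longrightarrow> act Y p y \<in> points Y"
  using Y.element_image by blast

lemma X_one: "x \<in> points X \<Longrightarrow> act X (\<one>\<^bsub>A\<^esub>, \<one>\<^bsub>G\<^esub>, \<one>\<^bsub>H\<^esub>) x = x"
  using X.id_eq_one by (metis one_DirProd restrict_apply')

lemma Y_one: "y \<in> points Y \<Longrightarrow> act Y (\<one>\<^bsub>A\<^esub>, \<one>\<^bsub>H\<^esub>, \<one>\<^bsub>K\<^esub>) y = y"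
  using Y.id_eq_one by (metis one_DirProd restrict_apply')

lemma X_mult:
  assumes "x \<in> points X" "a \<in> carrier A" "g \<in> carrier G" "h \<in> carrier H"
    "a' \<in> carrier A" "g' \<in> carrier G" "h' \<in> carrier H"
  shows "act X (a, g, h) (act X (a', g', h') x) = act X (a \<otimes>\<^bsub>A\<^esub> a', g \<otimes>\<^bsub>G\<^esub> g', h \<otimes>\<^bsub>H\<^esub> h') x"
  using assms X.composition_rule[of x "(a, g, h)" "(a', g', h')"] by simp

lemma Y_mult:
  assumes "y \<in> points Y" "a \<in> carrier A" "h \<in> carrier H" "k \<in> carrier K"
    "a' \<in> carrier A" "h' \<in> carrier H" "k' \<in> carrier K"
  shows "act Y (a, h, k) (act Y (a', h', k') y) = act Y (a \<otimes>\<^bsub>A\<^esub> a', h \<otimes>\<^bsub>H\<^esub> h', k \<otimes>\<^bsub>K\<^esub> k') y"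
  using assms Y.composition_rule[of y "(a, h, k)" "(a', h', k')"] by simp

sublocale pairs: group_action "A \<times>\<times> H" "points X \<times> points Y" "pair_act A G H K X Y"
proof (rule group_actionI)
  show "group (A \<times>\<times> H)" by (intro DirProd_group) unfold_locales
next
  fix p q xy assume "p \<in> carrier (A \<times>\<times> H)" "q \<in> carrier (A \<times>\<times> H)" "xy \<in> points X \<times> points Y"
  then show "pair_act A G H K X Y (p \<otimes>\<^bsub>A \<times>\<times> H\<^esub> q) xy =
      pair_act A G H K X Y p (pair_act A G H K X Y q xy)"
    by (auto simp: pair_act_def X_closed Y_closed X_mult Y_mult A.inv_mult)
qed (auto simp: pair_act_def X_closed Y_closed X_one Y_one extensional_def)

lemma points_Z: "points Z = {cls x y | x y. x \<in> points X \<and> y \<in> points Y}"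
  by (auto simp: pair_classes_def pair_class_def orbits_def)

lemma cls_eq_iff:
  assumes "x \<in> points X" "y \<in> points Y" "x' \<in> points X" "y' \<in> points Y"
  shows "cls x y = cls x' y' \<longleftrightarrow>
    (\<exists>b \<in> carrier A. \<exists>h \<in> carrier H. x' = act X (inv\<^bsub>A\<^esub> b, \<one>\<^bsub>G\<^esub>, h) x \<and> y' = act Y (b, h, \<one>\<^bsub>K\<^esub>) y)"
proof -
  have mem: "(x, y) \<in> points X \<times> points Y" "(x', y') \<in> points X \<times> points Y" using assms by auto
  have "cls x y = cls x' y' \<longleftrightarrow> (x', y') \<in> orbit (A \<times>\<times> H) (pair_act A G H K X Y) (x, y)"
  proof
    assume "cls x y = cls x' y'"
    then show "(x', y') \<in> orbit (A \<times>\<times> H) (pair_act A G H K X Y) (x, y)"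
      using pairs.orbit_refl[OF mem(2)] by (simp add: pair_class_def)
  next
    assume *: "(x', y') \<in> orbit (A \<times>\<times> H) (pair_act A G H K X Y) (x, y)"
    have orbs: "cls x y \<in> orbits (A \<times>\<times> H) (points X \<times> points Y) (pair_act A G H K X Y)"
      "cls x' y' \<in> orbits (A \<times>\<times> H) (points X \<times> points Y) (pair_act A G H K X Y)"
      using mem unfolding orbits_def pair_class_def by blast+
    show "cls x y = cls x' y'"
      using pairs.disjoint_union[OF orbs] * pairs.orbit_refl[OF mem(2)]
      by (auto simp: pair_class_def)
  qed
  then show ?thesis
    using assms by (auto simp: orbit_def pair_act_def)
qed

lemma act_Z:
  assumes "x \<in> points X" "y \<in> points Y" "a \<in> carrier A" "g \<in> carrier G" "k \<in> carrier K"
  shows "act Z (a, g, k) (cls x y) = cls (act X (a, g, \<one>\<^bsub>H\<^esub>) x) (act Y (\<one>\<^bsub>A\<^esub>, \<one>\<^bsub>H\<^esub>, k) y)"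
  by (rule act_pair_class[OF A.comm_group_axioms G.is_group H.is_group K.is_group X Y assms])

sublocale Z: group_action "A \<times>\<times> G \<times>\<times> K" "points Z" "act Z"
proof (rule group_actionI)
  show "group (A \<times>\<times> G \<times>\<times> K)" by (intro DirProd_group) unfold_locales
next
  fix p q C assume pq: "p \<in> carrier (A \<times>\<times> G \<times>\<times> K)" "q \<in> carrier (A \<times>\<times> G \<times>\<times> K)" and "C \<in> points Z"
  then obtain x y where "x \<in> points X" "y \<in> points Y" "C = cls x y" by (auto simp: points_Z)
  with pq show "act Z (p \<otimes>\<^bsub>A \<times>\<times> G \<times>\<times> K\<^esub> q) C = act Z p (act Z q C)"
    by (auto simp: act_Z X_closed Y_closed X_mult Y_mult)
next
  fix C assume "C \<in> points Z"
  then obtain x y where "x \<in> points X" "y \<in> points Y" "C = cls x y" by (auto simp: points_Z)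
  then show "act Z \<one>\<^bsub>A \<times>\<times> G \<times>\<times> K\<^esub> C = C" by (simp add: act_Z X_one Y_one)
next
  fix p C assume "p \<in> carrier (A \<times>\<times> G \<times>\<times> K)" "C \<in> points Z"
  then show "act Z p C \<in> points Z"
    by (auto simp: points_Z act_Z) (metis X_closed Y_closed A.one_closed G.one_closed H.one_closed
        K.one_closed SigmaI carrier_DirProd)
next
  fix p show "act Z p \<in> extensional (points Z)"
    by (cases p) (simp add: pair_classes_def)
qed

lemma points_L: "points L = {C \<in> points Z. stabilizer A (A_act G K Z) C = {\<one>\<^bsub>A\<^esub>}}"
  by (simp add: tensor_def Let_def)

lemma act_L: "act L p = restrict (act Z p) (points L)"
  by (simp add: tensor_def Let_def)

lemma Z_mult:
  assumes "C \<in> points Z" "a \<in> carrier A" "g \<in> carrier G" "k \<in> carrier K"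
    "a' \<in> carrier A" "g' \<in> carrier G" "k' \<in> carrier K"
  shows "act Z (a, g, k) (act Z (a', g', k') C) = act Z (a \<otimes>\<^bsub>A\<^esub> a', g \<otimes>\<^bsub>G\<^esub> g', k \<otimes>\<^bsub>K\<^esub> k') C"
  using assms Z.composition_rule[of C "(a, g, k)" "(a', g', k')"] by simp

text \<open>
Because \<open>A\<close> is abelian, its copy in \<open>A \<times> G \<times> K\<close> is central, so the stabilizer in \<open>A\<close> is constant on
orbits. This makes the tensor product an invariant subset of the set of classes.
\<close>

lemma stabilizer_A_invariant:
  assumes p: "p \<in> carrier (A \<times>\<times> G \<times>\<times> K)" and C: "C \<in> points Z"
  shows "stabilizer A (A_act G K Z) (act Z p C) = stabilizer A (A_act G K Z) C"
proof -
  have "A_act G K Z a (act Z p C) = act Z p C \<longleftrightarrow> A_act G K Z a C = C" if a: "a \<in> carrier A" for a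
  proof -
    obtain b g k where bgk: "p = (b, g, k)" "b \<in> carrier A" "g \<in> carrier G" "k \<in> carrier K"
      using p by auto
    have "A_act G K Z a (act Z p C) = act Z p (A_act G K Z a C)"
      using a bgk C by (simp add: A_act_def Z_mult A.m_comm)
    moreover have "A_act G K Z a C \<in> points Z"
      unfolding A_act_def using Z.element_image[OF _ C refl] a by simp
    ultimately show ?thesis
      using Z.inj_prop[OF p] C by (auto dest: inj_onD)
  qed
  then show ?thesis by (auto simp: stabilizer_def)
qed

lemma L_closed: "p \<in> carrier (A \<times>\<times> G \<times>\<times> K) \<Longrightarrow> C \<in> points L \<Longrightarrow> act Z p C \<in> points L"
  unfolding points_L using stabilizer_A_invariant Z.element_image by blast

lemma group_action_L: "group_action (A \<times>\<times> G \<times>\<times> K) (points L) (act L)"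
proof (rule group_actionI)
  show "group (A \<times>\<times> G \<times>\<times> K)" by (intro DirProd_group) unfold_locales
next
  fix p q C assume *: "p \<in> carrier (A \<times>\<times> G \<times>\<times> K)" "q \<in> carrier (A \<times>\<times> G \<times>\<times> K)" "C \<in> points L"
  then show "act L (p \<otimes>\<^bsub>A \<times>\<times> G \<times>\<times> K\<^esub> q) C = act L p (act L q C)"
    using Z.composition_rule[of C p q] L_closed[of q C] by (simp add: act_L points_L)
next
  fix C assume "C \<in> points L"
  then show "act L \<one>\<^bsub>A \<times>\<times> G \<times>\<times> K\<^esub> C = C"
    using Z.id_eq_one unfolding act_L points_L
    by (metis (no_types, lifting) mem_Collect_eq restrict_apply')
qed (use L_closed in \<open>auto simp: act_L\<close>)

text \<open>
The classes are balanced over \<open>A\<close>: this is the action of \<open>(a, 1) \<in> A \<times> H\<close> on pairs.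
\<close>

lemma cls_A_shift:
  assumes "x \<in> points X" "y \<in> points Y" "a \<in> carrier A"
  shows "cls x (act Y (a, \<one>\<^bsub>H\<^esub>, \<one>\<^bsub>K\<^esub>) y) = cls (act X (a, \<one>\<^bsub>G\<^esub>, \<one>\<^bsub>H\<^esub>) x) y"
proof -
  have "cls (act X (a, \<one>\<^bsub>G\<^esub>, \<one>\<^bsub>H\<^esub>) x) y = cls x (act Y (a, \<one>\<^bsub>H\<^esub>, \<one>\<^bsub>K\<^esub>) y)"
    using assms
    by (subst cls_eq_iff) (auto simp: X_closed Y_closed X_mult X_one intro!: bexI[of _ a] bexI[of _ "\<one>\<^bsub>H\<^esub>"])
  then show ?thesis ..
qed

lemma A_act_L:
  assumes "cls x y \<in> points L" "x \<in> points X" "y \<in> points Y" "a \<in> carrier A"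
  shows "A_act G K L a (cls x y) = cls (act X (a, \<one>\<^bsub>G\<^esub>, \<one>\<^bsub>H\<^esub>) x) y"
  using assms by (simp add: A_act_def act_L act_Z Y_one)

text \<open>
By \<open>cls_A_shift\<close>, moving \<open>x\<close> and \<open>y\<close> independently within their \<open>A\<close>-orbits gives nothing beyond the
\<open>A\<close>-orbit of the class. So the \<open>A\<close>-orbits of the tensor product are determined by pairs of \<open>A\<close>-orbits
of \<open>X\<close> and \<open>Y\<close>, and there are finitely many of them.
\<close>

lemma orbit_A_cls:
  assumes C: "cls x y \<in> points L" and x: "x \<in> points X" and y: "y \<in> points Y"
  shows "orbit A (A_act G K L) (cls x y) =
    {cls x' y' | x' y'. x' \<in> orbit A (A_act G H X) x \<and> y' \<in> orbit A (A_act H K Y) y}" (is "?l = ?r")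
proof
  show "?l \<subseteq> ?r"
  proof
    fix D assume "D \<in> ?l"
    then obtain a where a: "a \<in> carrier A" "D = cls (act X (a, \<one>\<^bsub>G\<^esub>, \<one>\<^bsub>H\<^esub>) x) y"
      using A_act_L[OF C x y] by (auto simp: orbit_def)
    moreover have "y \<in> orbit A (A_act H K Y) y"
      using Y_one[OF y] by (force simp: orbit_def A_act_def)
    ultimately show "D \<in> ?r" by (auto simp: orbit_def A_act_def)
  qed
next
  show "?r \<subseteq> ?l"
  proof clarify
    fix x' y' assume "x' \<in> orbit A (A_act G H X) x" "y' \<in> orbit A (A_act H K Y) y"
    then obtain a b where ab: "a \<in> carrier A" "b \<in> carrier A"
      and eq: "x' = act X (a, \<one>\<^bsub>G\<^esub>, \<one>\<^bsub>H\<^esub>) x" "y' = act Y (b, \<one>\<^bsub>H\<^esub>, \<one>\<^bsub>K\<^esub>) y"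
      by (auto simp: orbit_def A_act_def)
    have "cls x' y' = A_act G K L (b \<otimes>\<^bsub>A\<^esub> a) (cls x y)"
      using x y ab by (simp add: eq cls_A_shift X_closed X_mult A_act_L[OF C])
    then show "cls x' y' \<in> ?l" unfolding orbit_def using ab by blast
  qed
qed

lemma fibered_biset_L: "fibered_biset A G K L"
proof -
  have "stabilizer A (A_act G K L) C = {\<one>\<^bsub>A\<^esub>}" if "C \<in> points L" for C
  proof -
    have "stabilizer A (A_act G K L) C = stabilizer A (A_act G K Z) C"
      using that by (simp add: stabilizer_def A_act_def act_L)
    then show ?thesis using that by (simp add: points_L)
  qed
  moreover have "orbits A (points L) (A_act G K L) \<subseteq>
      (\<lambda>(P, Q). {cls x y | x y. x \<in> P \<and> y \<in> Q}) `
        (orbits A (points X) (A_act G H X) \<times> orbits A (points Y) (A_act H K Y))"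
  proof
    fix D assume "D \<in> orbits A (points L) (A_act G K L)"
    then obtain C where C: "C \<in> points L" "D = orbit A (A_act G K L) C" by (auto simp: orbits_def)
    then obtain x y where xy: "x \<in> points X" "y \<in> points Y" "C = cls x y"
      by (auto simp: points_L points_Z)
    then have "D = {cls x' y' | x' y'. x' \<in> orbit A (A_act G H X) x \<and> y' \<in> orbit A (A_act H K Y) y}"
      using C orbit_A_cls by simp
    then show "D \<in> (\<lambda>(P, Q). {cls x y | x y. x \<in> P \<and> y \<in> Q}) `
        (orbits A (points X) (A_act G H X) \<times> orbits A (points Y) (A_act H K Y))"
      using xy unfolding orbits_def by blast
  qed
  then have "finite (orbits A (points L) (A_act G K L))"
    by (rule finite_subset) (use X Y in \<open>auto simp: fibered_biset_def\<close>)
  ultimately show ?thesis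
    using group_action_L by (simp add: fibered_biset_def)
qed

end

section \<open>Representatives of double cosets\<close>

lemma mem_double_coset_iff:
  "y \<in> (P #>\<^bsub>G\<^esub> x) <#>\<^bsub>G\<^esub> Q \<longleftrightarrow> (\<exists>p \<in> P. \<exists>q \<in> Q. y = p \<otimes>\<^bsub>G\<^esub> x \<otimes>\<^bsub>G\<^esub> q)"
  by (auto simp: set_mult_def r_coset_def)

lemma double_coset_reps_cover:
  assumes "double_coset_reps G P Q R" "x \<in> carrier G"
  shows "\<exists>r \<in> R. \<exists>p \<in> P. \<exists>q \<in> Q. r = p \<otimes>\<^bsub>G\<^esub> x \<otimes>\<^bsub>G\<^esub> q"
proof -
  have "(P #>\<^bsub>G\<^esub> x) <#>\<^bsub>G\<^esub> Q \<in> double_cosets G P Q"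
    using assms(2) unfolding double_cosets_def by blast
  then obtain r where "r \<in> R" "r \<in> (P #>\<^bsub>G\<^esub> x) <#>\<^bsub>G\<^esub> Q"
    using assms(1) unfolding double_coset_reps_def by blast
  then show ?thesis unfolding mem_double_coset_iff by blast
qed

lemma (in group) double_coset_reps_unique:
  assumes R: "double_coset_reps G P Q R" and "\<one> \<in> P" "\<one> \<in> Q"
    and s: "s \<in> R" and "t \<in> R" "p \<in> P" "q \<in> Q" and eq: "t = p \<otimes> s \<otimes> q"
  shows "s = t"
proof -
  have car: "s \<in> carrier G" using R s by (auto simp: double_coset_reps_def)
  then have "s = \<one> \<otimes> s \<otimes> \<one>" by simp
  then have "s \<in> (P #> s) <#> Q" "t \<in> (P #> s) <#> Q"
    using assms unfolding mem_double_coset_iff by blast+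
  moreover have "(P #> s) <#> Q \<in> double_cosets G P Q"
    using car unfolding double_cosets_def by blast
  ultimately show ?thesis
    using R s \<open>t \<in> R\<close> unfolding double_coset_reps_def by blast
qed

section \<open>The Mackey formula\<close>

locale coset_biset_pair =
  A: comm_group A + G: group G + H: group H + K: group K
  for A :: "('a, 'm) monoid_scheme" and G :: "('g, 'n) monoid_scheme"
    and H :: "('h, 'o) monoid_scheme" and K :: "('k, 'q) monoid_scheme" +
  fixes U :: "('g \<times> 'h) set" and \<phi> :: "'g \<times> 'h \<Rightarrow> 'a"
    and V :: "('h \<times> 'k) set" and \<psi> :: "'h \<times> 'k \<Rightarrow> 'a"
  assumes finite_G: "finite (carrier G)" and finite_H: "finite (carrier H)"
    and finite_K: "finite (carrier K)"
    and \<phi>: "(U, \<phi>) \<in> char_pairs A (G \<times>\<times> H)"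
    and \<psi>: "(V, \<psi>) \<in> char_pairs A (H \<times>\<times> K)"
begin

sublocale U: subgroup U "G \<times>\<times> H" using char_pairsD(1)[OF \<phi>] .
sublocale V: subgroup V "H \<times>\<times> K" using char_pairsD(1)[OF \<psi>] .

abbreviation X where "X \<equiv> coset_biset A (G \<times>\<times> H) U \<phi>"
abbreviation Y where "Y \<equiv> coset_biset A (H \<times>\<times> K) V \<psi>"
abbreviation U\<phi> where "U\<phi> \<equiv> twist A U \<phi>"
abbreviation V\<psi> where "V\<psi> \<equiv> twist A V \<psi>"

sublocale fibered_biset_pair A G H K X Y
  by unfold_locales
    (intro fibered_biset_coset_biset A.comm_group_axioms G.is_group H.is_group K.is_group
      finite_G finite_H finite_K \<phi> \<psi>)+

sublocale GH: group "G \<times>\<times> H" by (intro DirProd_group) unfold_locales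
sublocale HK: group "H \<times>\<times> K" by (intro DirProd_group) unfold_locales
sublocale AGH: group "A \<times>\<times> G \<times>\<times> H" by (intro DirProd_group) unfold_locales
sublocale AHK: group "A \<times>\<times> H \<times>\<times> K" by (intro DirProd_group) unfold_locales
sublocale AGK: group "A \<times>\<times> G \<times>\<times> K" by (intro DirProd_group) unfold_locales

sublocale U\<phi>: subgroup U\<phi> "A \<times>\<times> G \<times>\<times> H"
  by (rule subgroup_twist[OF A.comm_group_axioms GH.is_group \<phi>])
sublocale V\<psi>: subgroup V\<psi> "A \<times>\<times> H \<times>\<times> K"
  by (rule subgroup_twist[OF A.comm_group_axioms HK.is_group \<psi>])

lemma U_car: "(g, h) \<in> U \<Longrightarrow> g \<in> carrier G \<and> h \<in> carrier H \<and> \<phi> (g, h) \<in> carrier A"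
  using U.subset char_pairsD(2)[OF \<phi>] by auto

lemma V_car: "(h, k) \<in> V \<Longrightarrow> h \<in> carrier H \<and> k \<in> carrier K \<and> \<psi> (h, k) \<in> carrier A"
  using V.subset char_pairsD(2)[OF \<psi>] by auto

lemma X_coset: "p \<in> carrier (A \<times>\<times> G \<times>\<times> H) \<Longrightarrow> p <#\<^bsub>A \<times>\<times> G \<times>\<times> H\<^esub> U\<phi> \<in> points X"
  by (auto simp: coset_biset_def LCOSETS_def)

lemma Y_coset: "p \<in> carrier (A \<times>\<times> H \<times>\<times> K) \<Longrightarrow> p <#\<^bsub>A \<times>\<times> H \<times>\<times> K\<^esub> V\<psi> \<in> points Y"
  by (auto simp: coset_biset_def LCOSETS_def)

lemma act_X_coset:
  assumes "a \<in> carrier A" "g \<in> carrier G" "h \<in> carrier H" "a' \<in> carrier A" "g' \<in> carrier G" "h' \<in> carrier H"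
  shows "act X (a, g, h) ((a', g', h') <#\<^bsub>A \<times>\<times> G \<times>\<times> H\<^esub> U\<phi>) =
    (a \<otimes>\<^bsub>A\<^esub> a', g \<otimes>\<^bsub>G\<^esub> g', h \<otimes>\<^bsub>H\<^esub> h') <#\<^bsub>A \<times>\<times> G \<times>\<times> H\<^esub> U\<phi>"
  using X_coset[of "(a', g', h')"] AGH.lcos_m_assoc[OF U\<phi>.subset, of "(a, g, h)" "(a', g', h')"] assms
  by (simp add: coset_biset_def)

lemma act_Y_coset:
  assumes "a \<in> carrier A" "h \<in> carrier H" "k \<in> carrier K" "a' \<in> carrier A" "h' \<in> carrier H" "k' \<in> carrier K"
  shows "act Y (a, h, k) ((a', h', k') <#\<^bsub>A \<times>\<times> H \<times>\<times> K\<^esub> V\<psi>) =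
    (a \<otimes>\<^bsub>A\<^esub> a', h \<otimes>\<^bsub>H\<^esub> h', k \<otimes>\<^bsub>K\<^esub> k') <#\<^bsub>A \<times>\<times> H \<times>\<times> K\<^esub> V\<psi>"
  using Y_coset[of "(a', h', k')"] AHK.lcos_m_assoc[OF V\<psi>.subset, of "(a, h, k)" "(a', h', k')"] assms
  by (simp add: coset_biset_def)

lemma U\<phi>_one_coset: "U\<phi> = (\<one>\<^bsub>A\<^esub>, \<one>\<^bsub>G\<^esub>, \<one>\<^bsub>H\<^esub>) <#\<^bsub>A \<times>\<times> G \<times>\<times> H\<^esub> U\<phi>"
  using AGH.lcos_mult_one[OF U\<phi>.subset] by simp

lemma X_coset_eq_iff:
  assumes "a \<in> carrier A" "g \<in> carrier G" "h \<in> carrier H" "a' \<in> carrier A" "g' \<in> carrier G" "h' \<in> carrier H"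
  shows "(a, g, h) <#\<^bsub>A \<times>\<times> G \<times>\<times> H\<^esub> U\<phi> = (a', g', h') <#\<^bsub>A \<times>\<times> G \<times>\<times> H\<^esub> U\<phi> \<longleftrightarrow>
    (inv\<^bsub>G\<^esub> g' \<otimes>\<^bsub>G\<^esub> g, inv\<^bsub>H\<^esub> h' \<otimes>\<^bsub>H\<^esub> h) \<in> U \<and>
    inv\<^bsub>A\<^esub> a' \<otimes>\<^bsub>A\<^esub> a = inv\<^bsub>A\<^esub> (\<phi> (inv\<^bsub>G\<^esub> g' \<otimes>\<^bsub>G\<^esub> g, inv\<^bsub>H\<^esub> h' \<otimes>\<^bsub>H\<^esub> h))"
  using AGH.l_coset_eq_iff[OF U\<phi>.subgroup_axioms, of "(a, g, h)" "(a', g', h')"] assms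
  by (simp add: inv_DirProd mem_twist_iff A.is_group G.is_group H.is_group GH.is_group)

lemma Y_coset_eq_iff:
  assumes "a \<in> carrier A" "h \<in> carrier H" "k \<in> carrier K" "a' \<in> carrier A" "h' \<in> carrier H" "k' \<in> carrier K"
  shows "(a, h, k) <#\<^bsub>A \<times>\<times> H \<times>\<times> K\<^esub> V\<psi> = (a', h', k') <#\<^bsub>A \<times>\<times> H \<times>\<times> K\<^esub> V\<psi> \<longleftrightarrow>
    (inv\<^bsub>H\<^esub> h' \<otimes>\<^bsub>H\<^esub> h, inv\<^bsub>K\<^esub> k' \<otimes>\<^bsub>K\<^esub> k) \<in> V \<and>
    inv\<^bsub>A\<^esub> a' \<otimes>\<^bsub>A\<^esub> a = inv\<^bsub>A\<^esub> (\<psi> (inv\<^bsub>H\<^esub> h' \<otimes>\<^bsub>H\<^esub> h, inv\<^bsub>K\<^esub> k' \<otimes>\<^bsub>K\<^esub> k))"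
  using AHK.l_coset_eq_iff[OF V\<psi>.subgroup_axioms, of "(a, h, k)" "(a', h', k')"] assms
  by (simp add: inv_DirProd mem_twist_iff A.is_group H.is_group K.is_group HK.is_group)

text \<open>
The class called \<open>z\<^sub>t\<close> above, for every \<open>t \<in> H\<close>; only for some \<open>t\<close> does it lie in the tensor product.
\<close>

definition base_class :: "'h \<Rightarrow> (('a \<times> 'g \<times> 'h) set \<times> ('a \<times> 'h \<times> 'k) set) set" where
  "base_class t = cls U\<phi> ((\<one>\<^bsub>A\<^esub>, t, \<one>\<^bsub>K\<^esub>) <#\<^bsub>A \<times>\<times> H \<times>\<times> K\<^esub> V\<psi>)"

lemma base_class_in_Z: "t \<in> carrier H \<Longrightarrow> base_class t \<in> points Z"
  using X_coset[of "(\<one>\<^bsub>A\<^esub>, \<one>\<^bsub>G\<^esub>, \<one>\<^bsub>H\<^esub>)"] Y_coset[of "(\<one>\<^bsub>A\<^esub>, t, \<one>\<^bsub>K\<^esub>)"]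
  by (auto simp: points_Z base_class_def simp flip: U\<phi>_one_coset)

lemma act_base_class:
  assumes "a \<in> carrier A" "g \<in> carrier G" "k \<in> carrier K" "t \<in> carrier H"
  shows "act Z (a, g, k) (base_class t) =
    cls ((a, g, \<one>\<^bsub>H\<^esub>) <#\<^bsub>A \<times>\<times> G \<times>\<times> H\<^esub> U\<phi>) ((\<one>\<^bsub>A\<^esub>, t, k) <#\<^bsub>A \<times>\<times> H \<times>\<times> K\<^esub> V\<psi>)"
  unfolding base_class_def
  by (subst (1) U\<phi>_one_coset) (use assms in \<open>simp add: act_Z X_coset Y_coset act_X_coset act_Y_coset\<close>)

text \<open>
The translate on the left is the class of \<open>((a, g, 1) U\<^sub>\<phi>, (1, s, k) V\<^sub>\<psi>)\<close>. It equals the class of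
\<open>(U\<^sub>\<phi>, (1, t, 1) V\<^sub>\<psi>)\<close> iff some \<open>(b, j) \<in> A \<times> H\<close> carries the latter pair to the former, that is,
\<open>(b a, g, j\<inverse>) \<in> U\<^sub>\<phi>\<close> and \<open>(b\<inverse>, t\<inverse> j\<inverse> s, k) \<in> V\<^sub>\<psi>\<close>. The second membership determines \<open>b\<close>, which is
then eliminated from the first, and \<open>h = j\<inverse>\<close>.
\<close>

lemma act_base_class_eq_iff:
  assumes a: "a \<in> carrier A" and g: "g \<in> carrier G" and k: "k \<in> carrier K"
    and s: "s \<in> carrier H" and t: "t \<in> carrier H"
  shows "act Z (a, g, k) (base_class s) = base_class t \<longleftrightarrow>
    (\<exists>h \<in> carrier H. (g, h) \<in> U \<and> (inv\<^bsub>H\<^esub> t \<otimes>\<^bsub>H\<^esub> h \<otimes>\<^bsub>H\<^esub> s, k) \<in> V \<and>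
      a = inv\<^bsub>A\<^esub> (\<phi> (g, h) \<otimes>\<^bsub>A\<^esub> \<psi> (inv\<^bsub>H\<^esub> t \<otimes>\<^bsub>H\<^esub> h \<otimes>\<^bsub>H\<^esub> s, k)))"
    (is "?l \<longleftrightarrow> (\<exists>h \<in> carrier H. ?Q h)")
proof -
  let ?E = "\<lambda>b j. (a, g, \<one>\<^bsub>H\<^esub>) <#\<^bsub>A \<times>\<times> G \<times>\<times> H\<^esub> U\<phi> = (inv\<^bsub>A\<^esub> b, \<one>\<^bsub>G\<^esub>, j) <#\<^bsub>A \<times>\<times> G \<times>\<times> H\<^esub> U\<phi> \<and>
      (\<one>\<^bsub>A\<^esub>, s, k) <#\<^bsub>A \<times>\<times> H \<times>\<times> K\<^esub> V\<psi> = (b, j \<otimes>\<^bsub>H\<^esub> t, \<one>\<^bsub>K\<^esub>) <#\<^bsub>A \<times>\<times> H \<times>\<times> K\<^esub> V\<psi>"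
  have "?l \<longleftrightarrow> base_class t = act Z (a, g, k) (base_class s)" by auto
  also have "\<dots> \<longleftrightarrow> cls ((\<one>\<^bsub>A\<^esub>, \<one>\<^bsub>G\<^esub>, \<one>\<^bsub>H\<^esub>) <#\<^bsub>A \<times>\<times> G \<times>\<times> H\<^esub> U\<phi>)
      ((\<one>\<^bsub>A\<^esub>, t, \<one>\<^bsub>K\<^esub>) <#\<^bsub>A \<times>\<times> H \<times>\<times> K\<^esub> V\<psi>) = act Z (a, g, k) (base_class s)"
    by (simp add: base_class_def flip: U\<phi>_one_coset)
  also have "\<dots> \<longleftrightarrow> (\<exists>b \<in> carrier A. \<exists>j \<in> carrier H. ?E b j)"
    using assms
    by (simp add: act_base_class cls_eq_iff X_coset Y_coset act_X_coset act_Y_coset cong: bex_cong)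
  also have "\<dots> \<longleftrightarrow> (\<exists>b \<in> carrier A. \<exists>j \<in> carrier H. b = \<psi> (inv\<^bsub>H\<^esub> t \<otimes>\<^bsub>H\<^esub> inv\<^bsub>H\<^esub> j \<otimes>\<^bsub>H\<^esub> s, k) \<and> ?Q (inv\<^bsub>H\<^esub> j))"
  proof (intro bex_cong refl)
    fix b j assume b: "b \<in> carrier A" and j: "j \<in> carrier H"
    have 1: "inv\<^bsub>H\<^esub> (j \<otimes>\<^bsub>H\<^esub> t) \<otimes>\<^bsub>H\<^esub> s = inv\<^bsub>H\<^esub> t \<otimes>\<^bsub>H\<^esub> inv\<^bsub>H\<^esub> j \<otimes>\<^bsub>H\<^esub> s"
      using j t by (simp add: H.inv_mult_group)
    have "?E b j \<longleftrightarrow> ((g, inv\<^bsub>H\<^esub> j) \<in> U \<and> b \<otimes>\<^bsub>A\<^esub> a = inv\<^bsub>A\<^esub> (\<phi> (g, inv\<^bsub>H\<^esub> j))) \<and>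
        (inv\<^bsub>H\<^esub> t \<otimes>\<^bsub>H\<^esub> inv\<^bsub>H\<^esub> j \<otimes>\<^bsub>H\<^esub> s, k) \<in> V \<and>
        inv\<^bsub>A\<^esub> b = inv\<^bsub>A\<^esub> (\<psi> (inv\<^bsub>H\<^esub> t \<otimes>\<^bsub>H\<^esub> inv\<^bsub>H\<^esub> j \<otimes>\<^bsub>H\<^esub> s, k))"
      using assms b j by (simp add: X_coset_eq_iff Y_coset_eq_iff 1)
    also have "\<dots> \<longleftrightarrow> b = \<psi> (inv\<^bsub>H\<^esub> t \<otimes>\<^bsub>H\<^esub> inv\<^bsub>H\<^esub> j \<otimes>\<^bsub>H\<^esub> s, k) \<and> ?Q (inv\<^bsub>H\<^esub> j)"
    proof -
      have "b \<otimes>\<^bsub>A\<^esub> a = inv\<^bsub>A\<^esub> c \<longleftrightarrow> a = inv\<^bsub>A\<^esub> (c \<otimes>\<^bsub>A\<^esub> b)" if "c \<in> carrier A" for c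
        using a b that A.inv_solve_left[of a b "inv\<^bsub>A\<^esub> c"] by (auto simp: A.inv_mult_group)
      moreover have "inv\<^bsub>A\<^esub> b = inv\<^bsub>A\<^esub> c \<longleftrightarrow> b = c" if "c \<in> carrier A" for c
        using b that by (metis A.inv_inv)
      ultimately show ?thesis using U_car V_car by blast
    qed
    finally show "?E b j \<longleftrightarrow> b = \<psi> (inv\<^bsub>H\<^esub> t \<otimes>\<^bsub>H\<^esub> inv\<^bsub>H\<^esub> j \<otimes>\<^bsub>H\<^esub> s, k) \<and> ?Q (inv\<^bsub>H\<^esub> j)" .
  qed
  also have "\<dots> \<longleftrightarrow> (\<exists>j \<in> carrier H. ?Q (inv\<^bsub>H\<^esub> j))" using V_car by blast
  also have "\<dots> \<longleftrightarrow> (\<exists>h \<in> carrier H. ?Q h)" using H.inv_closed H.inv_inv by metis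
  finally show ?thesis .
qed

text \<open>
The components in \<open>A\<close>, \<open>G\<close> and \<open>K\<close> can be pulled out of a class, and the two components in \<open>H\<close>
merged, by acting on the pair with \<open>(b, h) \<in> A \<times> H\<close>.
\<close>

lemma cls_eq_act_base_class:
  assumes "a \<in> carrier A" "g \<in> carrier G" "h \<in> carrier H" "b \<in> carrier A" "h' \<in> carrier H" "k \<in> carrier K"
  shows "cls ((a, g, h) <#\<^bsub>A \<times>\<times> G \<times>\<times> H\<^esub> U\<phi>) ((b, h', k) <#\<^bsub>A \<times>\<times> H \<times>\<times> K\<^esub> V\<psi>) =
    act Z (a \<otimes>\<^bsub>A\<^esub> b, g, k) (base_class (inv\<^bsub>H\<^esub> h \<otimes>\<^bsub>H\<^esub> h'))"
proof -
  have "inv\<^bsub>A\<^esub> b \<otimes>\<^bsub>A\<^esub> (a \<otimes>\<^bsub>A\<^esub> b) = a"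
    using assms by (simp add: A.m_comm[of a b] A.m_assoc[symmetric])
  moreover have "h \<otimes>\<^bsub>H\<^esub> (inv\<^bsub>H\<^esub> h \<otimes>\<^bsub>H\<^esub> h') = h'"
    using assms by (simp add: H.m_assoc[symmetric])
  ultimately have "act Z (a \<otimes>\<^bsub>A\<^esub> b, g, k) (base_class (inv\<^bsub>H\<^esub> h \<otimes>\<^bsub>H\<^esub> h')) =
    cls ((a, g, h) <#\<^bsub>A \<times>\<times> G \<times>\<times> H\<^esub> U\<phi>) ((b, h', k) <#\<^bsub>A \<times>\<times> H \<times>\<times> K\<^esub> V\<psi>)"
    using assms
    by (subst act_base_class; simp?; subst cls_eq_iff; simp add: X_coset Y_coset act_X_coset act_Y_coset)
      (intro bexI[of _ b] bexI[of _ h]; simp add: act_X_coset act_Y_coset)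
  then show ?thesis ..
qed

text \<open>
A class is a translate of \<open>z\<^sub>s\<close> for some \<open>s \<in> H\<close>. If \<open>r = u s v\<close> represents the double coset of \<open>s\<close>
and \<open>(g', u) \<in> U\<close>, \<open>(v, k') \<in> V\<close>, then \<open>h = u\<close> is a solution in \<open>act_base_class_eq_iff\<close> because
\<open>r\<inverse> u s = v\<inverse>\<close>; hence \<open>z\<^sub>s\<close> is a translate of \<open>z\<^sub>r\<close>.
\<close>

lemma Z_points_eq_act_base_class:
  assumes R: "double_coset_reps H (snd ` U) (fst ` V) R" and C: "C \<in> points Z"
  shows "\<exists>r \<in> R. \<exists>p \<in> carrier (A \<times>\<times> G \<times>\<times> K). act Z p (base_class r) = C"
proof -
  obtain x y where "x \<in> points X" "y \<in> points Y" and Cxy: "C = cls x y"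
    using C by (auto simp: points_Z)
  then obtain a g h b h' k where car: "a \<in> carrier A" "g \<in> carrier G" "h \<in> carrier H"
      "b \<in> carrier A" "h' \<in> carrier H" "k \<in> carrier K"
    and xy: "x = (a, g, h) <#\<^bsub>A \<times>\<times> G \<times>\<times> H\<^esub> U\<phi>" "y = (b, h', k) <#\<^bsub>A \<times>\<times> H \<times>\<times> K\<^esub> V\<psi>"
    by (auto simp: coset_biset_def LCOSETS_def)
  define s where "s = inv\<^bsub>H\<^esub> h \<otimes>\<^bsub>H\<^esub> h'"
  have s: "s \<in> carrier H" using car by (simp add: s_def)
  define q where "q = (a \<otimes>\<^bsub>A\<^esub> b, g, k)"
  have q: "q \<in> carrier (A \<times>\<times> G \<times>\<times> K)" using car by (simp add: q_def)
  have Cq: "C = act Z q (base_class s)"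
    unfolding Cxy xy q_def s_def using car by (rule cls_eq_act_base_class)
  obtain r u v where r: "r \<in> R" and "u \<in> snd ` U" "v \<in> fst ` V" and eq: "r = u \<otimes>\<^bsub>H\<^esub> s \<otimes>\<^bsub>H\<^esub> v"
    using double_coset_reps_cover[OF R s] by blast
  then obtain g' k' where gu: "(g', u) \<in> U" and vk: "(v, k') \<in> V" by auto
  have r': "r \<in> carrier H" using U_car[OF gu] V_car[OF vk] s by (simp add: eq)
  have inv_vk: "(inv\<^bsub>H\<^esub> v, inv\<^bsub>K\<^esub> k') \<in> V"
    using V.m_inv_closed[OF vk] V_car[OF vk] by (simp add: inv_DirProd H.is_group K.is_group)
  have "inv\<^bsub>H\<^esub> r \<otimes>\<^bsub>H\<^esub> u \<otimes>\<^bsub>H\<^esub> s = inv\<^bsub>H\<^esub> v"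
    using U_car[OF gu] V_car[OF vk] s by (simp add: eq H.inv_mult_group H.m_assoc)
  then have "\<exists>c \<in> carrier A. act Z (c, g', inv\<^bsub>K\<^esub> k') (base_class s) = base_class r"
    using gu inv_vk U_car[OF gu] V_car[OF vk] V_car[OF inv_vk] s r'
    by (auto simp: act_base_class_eq_iff intro!: bexI[of _ u])
  then obtain p where p: "p \<in> carrier (A \<times>\<times> G \<times>\<times> K)" "act Z p (base_class s) = base_class r"
    using U_car[OF gu] V_car[OF inv_vk] by auto
  have "act Z (q \<otimes>\<^bsub>A \<times>\<times> G \<times>\<times> K\<^esub> inv\<^bsub>A \<times>\<times> G \<times>\<times> K\<^esub> p) (base_class r) = C"
    using Z.composition_rule[OF base_class_in_Z[OF r'] q AGK.inv_closed[OF p(1)]]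
      Z.orbit_sym_aux[OF p(1) base_class_in_Z[OF s] p(2)] Cq by simp
  then show ?thesis using r AGK.m_closed[OF q AGK.inv_closed[OF p(1)]] by blast
qed

text \<open>
The element \<open>v = t\<inverse> h s\<close> of \<open>act_base_class_eq_iff\<close> is in \<open>p\<^sub>1 V\<close>, and \<open>t = h s v\<inverse>\<close> with \<open>h \<in> p\<^sub>2 U\<close>.
\<close>

lemma base_class_orbits_distinct:
  assumes R: "double_coset_reps H (snd ` U) (fst ` V) R" and s: "s \<in> R" and t: "t \<in> R"
    and p: "p \<in> carrier (A \<times>\<times> G \<times>\<times> K)" and eq: "act Z p (base_class s) = base_class t"
  shows "s = t"
proof -
  have car: "s \<in> carrier H" "t \<in> carrier H" using R s t by (auto simp: double_coset_reps_def)
  obtain a g k where agk: "p = (a, g, k)" "a \<in> carrier A" "g \<in> carrier G" "k \<in> carrier K"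
    using p by auto
  obtain h where h: "h \<in> carrier H" "(g, h) \<in> U" "(inv\<^bsub>H\<^esub> t \<otimes>\<^bsub>H\<^esub> h \<otimes>\<^bsub>H\<^esub> s, k) \<in> V"
    using eq agk car by (auto simp: act_base_class_eq_iff)
  define v where "v = inv\<^bsub>H\<^esub> t \<otimes>\<^bsub>H\<^esub> h \<otimes>\<^bsub>H\<^esub> s"
  have "(inv\<^bsub>H\<^esub> v, inv\<^bsub>K\<^esub> k) \<in> V"
    using V.m_inv_closed[OF h(3)] V_car[OF h(3)]
    by (simp add: inv_DirProd H.is_group K.is_group v_def)
  then have "inv\<^bsub>H\<^esub> v \<in> fst ` V" by force
  moreover have "h \<in> snd ` U" using h(2) by force
  moreover have "t = h \<otimes>\<^bsub>H\<^esub> s \<otimes>\<^bsub>H\<^esub> inv\<^bsub>H\<^esub> v"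
  proof -
    have v: "v \<in> carrier H" using car h(1) by (simp add: v_def)
    have "h \<otimes>\<^bsub>H\<^esub> s = t \<otimes>\<^bsub>H\<^esub> v" using car h(1) by (simp add: v_def H.m_assoc[symmetric])
    then show ?thesis using car v by (simp add: H.m_assoc)
  qed
  moreover have "\<one>\<^bsub>H\<^esub> \<in> snd ` U" "\<one>\<^bsub>H\<^esub> \<in> fst ` V" using U.one_closed V.one_closed by force+
  ultimately show ?thesis using H.double_coset_reps_unique[OF R] s t by blast
qed

abbreviation Ht where "Ht t \<equiv> k2 G H U \<inter> conj_set H t (k1 H K V)"

lemma mem_Ht_iff:
  assumes t: "t \<in> carrier H"
  shows "h \<in> Ht t \<longleftrightarrow> h \<in> carrier H \<and> (\<one>\<^bsub>G\<^esub>, h) \<in> U \<and> (inv\<^bsub>H\<^esub> t \<otimes>\<^bsub>H\<^esub> h \<otimes>\<^bsub>H\<^esub> t, \<one>\<^bsub>K\<^esub>) \<in> V"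
proof -
  have "k1 H K V \<subseteq> carrier H" by (auto simp: k1_def)
  from H.mem_conj_set_iff[OF t this] show ?thesis
    using t by (auto simp: k1_def k2_def)
qed

definition compatible :: "'h \<Rightarrow> bool" where
  "compatible t \<longleftrightarrow> (\<forall>h \<in> Ht t. char2 A G \<phi> h = conj_char H t (char1 K \<psi>) h)"

text \<open>
By \<open>act_base_class_eq_iff\<close> the stabilizer of \<open>z\<^sub>t\<close> in \<open>A\<close> consists of the quotients of the two
characters at the elements of \<open>H\<^sub>t\<close>. The inverse in the definition of \<open>char2\<close> is what turns the
product of \<open>\<phi>\<close> and \<open>\<psi>\<close> into a quotient.
\<close>

lemma base_class_in_L_iff:
  assumes t: "t \<in> carrier H"
  shows "base_class t \<in> points L \<longleftrightarrow> compatible t"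
proof -
  have stab: "a \<in> stabilizer A (A_act G K Z) (base_class t) \<longleftrightarrow>
      (\<exists>h \<in> Ht t.
         a = char2 A G \<phi> h \<otimes>\<^bsub>A\<^esub> inv\<^bsub>A\<^esub> (conj_char H t (char1 K \<psi>) h))" for a
  proof -
    have "a \<in> stabilizer A (A_act G K Z) (base_class t) \<longleftrightarrow> a \<in> carrier A \<and>
       (\<exists>h \<in> Ht t.
         a = inv\<^bsub>A\<^esub> (\<phi> (\<one>\<^bsub>G\<^esub>, h) \<otimes>\<^bsub>A\<^esub> \<psi> (inv\<^bsub>H\<^esub> t \<otimes>\<^bsub>H\<^esub> h \<otimes>\<^bsub>H\<^esub> t, \<one>\<^bsub>K\<^esub>)))"
    proof (cases "a \<in> carrier A")
      case True
      then show ?thesis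
        unfolding Bex_def mem_Ht_iff[OF t]
        using act_base_class_eq_iff[OF True G.one_closed K.one_closed t t]
        by (simp add: stabilizer_def A_act_def Bex_def conj_assoc)
    qed (simp add: stabilizer_def)
    moreover have "inv\<^bsub>A\<^esub> (\<phi> (\<one>\<^bsub>G\<^esub>, h) \<otimes>\<^bsub>A\<^esub> \<psi> (inv\<^bsub>H\<^esub> t \<otimes>\<^bsub>H\<^esub> h \<otimes>\<^bsub>H\<^esub> t, \<one>\<^bsub>K\<^esub>)) =
        char2 A G \<phi> h \<otimes>\<^bsub>A\<^esub> inv\<^bsub>A\<^esub> (conj_char H t (char1 K \<psi>) h)"
      "char2 A G \<phi> h \<otimes>\<^bsub>A\<^esub> inv\<^bsub>A\<^esub> (conj_char H t (char1 K \<psi>) h) \<in> carrier A"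
      if "h \<in> Ht t" for h
      using that[unfolded mem_Ht_iff[OF t]] U_car V_car t
      by (auto simp: A.inv_mult char2_def char1_def conj_char_def)
    ultimately show ?thesis by auto
  qed
  have eq1: "char2 A G \<phi> h \<otimes>\<^bsub>A\<^esub> inv\<^bsub>A\<^esub> (conj_char H t (char1 K \<psi>) h) = \<one>\<^bsub>A\<^esub> \<longleftrightarrow>
      char2 A G \<phi> h = conj_char H t (char1 K \<psi>) h"
    if "h \<in> Ht t" for h
  proof -
    have "char2 A G \<phi> h \<in> carrier A" "conj_char H t (char1 K \<psi>) h \<in> carrier A"
      using that[unfolded mem_Ht_iff[OF t]] U_car V_car t
      by (auto simp: char2_def char1_def conj_char_def)
    then show ?thesis by (simp add: A.inv_solve_right')
  qed
  have "\<one>\<^bsub>A\<^esub> \<in> stabilizer A (A_act G K Z) (base_class t)"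
    using Z.id_eq_one base_class_in_Z[OF t]
    by (simp add: stabilizer_def A_act_def) (metis restrict_apply')
  then have "base_class t \<in> points L \<longleftrightarrow> stabilizer A (A_act G K Z) (base_class t) \<subseteq> {\<one>\<^bsub>A\<^esub>}"
    using base_class_in_Z[OF t] by (auto simp: points_L)
  also have "\<dots> \<longleftrightarrow> compatible t"
    unfolding compatible_def subset_iff stab singleton_iff using eq1 by blast
  finally show ?thesis .
qed

abbreviation tV where "tV t \<equiv> conj_set (H \<times>\<times> K) (t, \<one>\<^bsub>K\<^esub>) V"
abbreviation t\<psi> where "t\<psi> t \<equiv> conj_char (H \<times>\<times> K) (t, \<one>\<^bsub>K\<^esub>) \<psi>"

lemma conj_tK:
  assumes "t \<in> carrier H" "h \<in> carrier H" "k \<in> carrier K"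
  shows "inv\<^bsub>H \<times>\<times> K\<^esub> (t, \<one>\<^bsub>K\<^esub>) \<otimes>\<^bsub>H \<times>\<times> K\<^esub> (h, k) \<otimes>\<^bsub>H \<times>\<times> K\<^esub> (t, \<one>\<^bsub>K\<^esub>) =
    (inv\<^bsub>H\<^esub> t \<otimes>\<^bsub>H\<^esub> h \<otimes>\<^bsub>H\<^esub> t, k)"
  using assms by (simp add: inv_DirProd H.is_group K.is_group)

lemma mem_tV_iff:
  assumes "t \<in> carrier H"
  shows "(h, k) \<in> tV t \<longleftrightarrow> h \<in> carrier H \<and> k \<in> carrier K \<and> (inv\<^bsub>H\<^esub> t \<otimes>\<^bsub>H\<^esub> h \<otimes>\<^bsub>H\<^esub> t, k) \<in> V"
  using assms HK.mem_conj_set_iff[OF _ V.subset, of "(t, \<one>\<^bsub>K\<^esub>)" "(h, k)"] conj_tK[OF assms]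
  by (auto simp del: mult_DirProd)

text \<open>
Compatibility is used to evaluate the product character at \<open>(g, k)\<close> through whichever \<open>h\<close> comes
with \<open>act_base_class_eq_iff\<close>, rather than through the one chosen in the definition of \<open>star_char\<close>.
\<close>

lemma stabilizer_base_class:
  assumes t: "t \<in> carrier H" and comp: "compatible t"
  shows "stabilizer (A \<times>\<times> G \<times>\<times> K) (act Z) (base_class t) =
    twist A (U O tV t) (star_char A U (tV t) \<phi> (t\<psi> t))"
proof -
  have t1: "(t, \<one>\<^bsub>K\<^esub>) \<in> carrier (H \<times>\<times> K)" using t by simp
  have star: "star_char A U (tV t) \<phi> (t\<psi> t) (g, k) =
      \<phi> (g, h) \<otimes>\<^bsub>A\<^esub> \<psi> (inv\<^bsub>H\<^esub> t \<otimes>\<^bsub>H\<^esub> h \<otimes>\<^bsub>H\<^esub> t, k)"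
    if gh: "(g, h) \<in> U" and hk: "(h, k) \<in> tV t" for g h k
  proof -
    have "star_char A U (tV t) \<phi> (t\<psi> t) (g, k) = \<phi> (g, h) \<otimes>\<^bsub>A\<^esub> t\<psi> t (h, k)"
    proof (rule star_char_eq[OF A.comm_group_axioms G.is_group H.is_group K.is_group \<phi>
          conj_char_pairs[OF HK.is_group t1 \<psi>] _ gh hk])
      fix h assume h: "h \<in> k2 G H U \<inter> k1 H K (tV t)"
      then have "h \<in> Ht t"
        unfolding mem_Ht_iff[OF t] by (auto simp: k1_def k2_def mem_tV_iff[OF t])
      then have "char2 A G \<phi> h = conj_char H t (char1 K \<psi>) h"
        using comp by (auto simp: compatible_def)
      moreover have "h \<in> carrier H" using h by (auto simp: k2_def)
      ultimately show "char2 A G \<phi> h = char1 K (t\<psi> t) h"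
        using conj_tK[OF t, of h "\<one>\<^bsub>K\<^esub>"] by (simp add: conj_char_def char1_def del: mult_DirProd)
    qed
    moreover have "h \<in> carrier H" "k \<in> carrier K" using hk t by (auto simp: mem_tV_iff)
    ultimately show ?thesis
      using conj_tK[OF t, of h k] by (simp add: conj_char_def del: mult_DirProd)
  qed
  have "(a, g, k) \<in> stabilizer (A \<times>\<times> G \<times>\<times> K) (act Z) (base_class t) \<longleftrightarrow>
      (a, g, k) \<in> twist A (U O tV t) (star_char A U (tV t) \<phi> (t\<psi> t))" for a g k
  proof -
    have "(a, g, k) \<in> stabilizer (A \<times>\<times> G \<times>\<times> K) (act Z) (base_class t) \<longleftrightarrow>
        (\<exists>h. (g, h) \<in> U \<and> (h, k) \<in> tV t \<and>
          a = inv\<^bsub>A\<^esub> (\<phi> (g, h) \<otimes>\<^bsub>A\<^esub> \<psi> (inv\<^bsub>H\<^esub> t \<otimes>\<^bsub>H\<^esub> h \<otimes>\<^bsub>H\<^esub> t, k)))"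
    proof (cases "a \<in> carrier A \<and> g \<in> carrier G \<and> k \<in> carrier K")
      case True
      then show ?thesis
        unfolding mem_tV_iff[OF t]
        using act_base_class_eq_iff[of a g k t t] t by (simp add: stabilizer_def Bex_def) blast
    next
      case False
      then show ?thesis
        unfolding mem_tV_iff[OF t] using U_car V_car by (auto simp: stabilizer_def)
    qed
    also have "\<dots> \<longleftrightarrow> (a, g, k) \<in> twist A (U O tV t) (star_char A U (tV t) \<phi> (t\<psi> t))"
      unfolding mem_twist_iff relcomp_unfold by (auto simp: star)
    finally show ?thesis .
  qed
  then show ?thesis by auto
qed

theorem mackey_formula:
  assumes R: "double_coset_reps H (snd ` U) (fst ` V) R"
  defines "T \<equiv> {t \<in> R. compatible t}"
    and "M \<equiv> coprod_gset {t \<in> R. compatible t}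
      (\<lambda>t. coset_biset A (G \<times>\<times> K) (U O tV t) (star_char A U (tV t) \<phi> (t\<psi> t)))"
  shows "\<exists>f \<in> fibered_biset_iso A G K L M. \<forall>t \<in> T.
    inv_into (points L) f (t, twist A (U O tV t) (star_char A U (tV t) \<phi> (t\<psi> t))) = base_class t"
proof -
  interpret L: group_action "A \<times>\<times> G \<times>\<times> K" "points L" "act L" by (rule group_action_L)
  have car: "t \<in> carrier H" if "t \<in> T" for t
    using that R by (auto simp: T_def double_coset_reps_def)
  have z: "base_class t \<in> points L" if "t \<in> T" for t
    using that car by (simp add: base_class_in_L_iff) (simp add: T_def)
  have act_eq: "act L p (base_class t) = act Z p (base_class t)" if "t \<in> T" for p t
    using z[OF that] by (simp add: act_L)
  let ?S = "\<lambda>t. twist A (U O tV t) (star_char A U (tV t) \<phi> (t\<psi> t))"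
  have stab: "stabilizer (A \<times>\<times> G \<times>\<times> K) (act L) (base_class t) = ?S t" if "t \<in> T" for t
    using stabilizer_base_class[OF car[OF that]] that act_eq[OF that]
    by (simp add: T_def stabilizer_def)
  have distinct: "s = t" if "s \<in> T" "t \<in> T" "p \<in> carrier (A \<times>\<times> G \<times>\<times> K)"
      "act L p (base_class s) = base_class t" for s t p
    using that base_class_orbits_distinct[OF R, of s t p] act_eq by (simp add: T_def)
  \<comment> \<open>An orbit that meets the tensor product lies in it, so its representative is compatible.\<close>
  have cover: "\<exists>t \<in> T. \<exists>p \<in> carrier (A \<times>\<times> G \<times>\<times> K). act L p (base_class t) = C"
    if C: "C \<in> points L" for C
  proof -
    obtain t p where t: "t \<in> R" and p: "p \<in> carrier (A \<times>\<times> G \<times>\<times> K)"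
      and eq: "act Z p (base_class t) = C"
      using Z_points_eq_act_base_class[OF R, of C] C by (auto simp: points_L)
    have tH: "t \<in> carrier H" using t R by (auto simp: double_coset_reps_def)
    have "base_class t \<in> points L"
      using C stabilizer_A_invariant[OF p base_class_in_Z[OF tH]] base_class_in_Z[OF tH]
      by (simp add: points_L eq)
    then have "t \<in> T" using t tH by (simp add: T_def base_class_in_L_iff)
    then show ?thesis using p eq act_eq by blast
  qed
  obtain f where f: "bij_betw f (points L)
        (SIGMA t:T. lcosets\<^bsub>A \<times>\<times> G \<times>\<times> K\<^esub> (stabilizer (A \<times>\<times> G \<times>\<times> K) (act L) (base_class t)))"
    and f_act: "\<And>p x. p \<in> carrier (A \<times>\<times> G \<times>\<times> K) \<Longrightarrow> x \<in> points L \<Longrightarrow>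
        f (act L p x) = (fst (f x), p <#\<^bsub>A \<times>\<times> G \<times>\<times> K\<^esub> snd (f x))"
    and f_base: "\<And>t. t \<in> T \<Longrightarrow>
        f (base_class t) = (t, stabilizer (A \<times>\<times> G \<times>\<times> K) (act L) (base_class t))"
    by (rule L.orbit_decomposition[of T base_class, OF z distinct cover]) blast+
  have M: "points M = (SIGMA t:T. lcosets\<^bsub>A \<times>\<times> G \<times>\<times> K\<^esub> (?S t))"
    "act M p = restrict (\<lambda>(t, C). (t, p <#\<^bsub>A \<times>\<times> G \<times>\<times> K\<^esub> C)) (points M)" for p
    by (auto simp: M_def T_def coprod_gset_def coset_biset_def fun_eq_iff restrict_def)
  have bij: "bij_betw f (points L) (points M)"
    using f stab by (simp add: M cong: Sigma_cong)
  have equiv: "f (act L p x) = act M p (f x)"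
    if "p \<in> carrier (A \<times>\<times> G \<times>\<times> K)" "x \<in> points L" for p x
    using f_act[OF that] bij_betwE[OF bij] that(2) by (simp add: M(2) case_prod_beta)
  have "fibered_biset A G K M"
    by (rule fibered_biset_transport[OF A.comm_group_axioms G.is_group K.is_group fibered_biset_L bij _ equiv])
      (simp_all add: M(2))
  then have "f \<in> fibered_biset_iso A G K L M"
    using fibered_biset_L bij equiv by (simp add: fibered_biset_iso_def)
  moreover have "inv_into (points L) f (t, ?S t) = base_class t" if "t \<in> T" for t
    using inv_into_f_f[OF bij_betw_imp_inj_on[OF bij] z[OF that]] f_base[OF that] stab[OF that] by simp
  ultimately show ?thesis by blast
qed

end

theorem corollary2p5:
  fixes A :: "('a, 'm) monoid_scheme" and G :: "('g, 'n) monoid_scheme"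
    and H :: "('h, 'o) monoid_scheme" and K :: "('k, 'q) monoid_scheme"
    and U :: "('g \<times> 'h) set" and \<phi> :: "'g \<times> 'h \<Rightarrow> 'a"
    and V :: "('h \<times> 'k) set" and \<psi> :: "'h \<times> 'k \<Rightarrow> 'a"
    and R :: "'h set"
  assumes "comm_group A"
    and "group G" and "finite (carrier G)"
    and "group H" and "finite (carrier H)"
    and "group K" and "finite (carrier K)"
    and "(U, \<phi>) \<in> char_pairs A (G \<times>\<times> H)"
    and "(V, \<psi>) \<in> char_pairs A (H \<times>\<times> K)"
    and "double_coset_reps H (snd ` U) (fst ` V) R"
  shows "let Ht = (\<lambda>t. k2 G H U \<inter> conj_set H t (k1 H K V));
             T = {t \<in> R. restrict (char2 A G \<phi>) (Ht t) = restrict (conj_char H t (char1 K \<psi>)) (Ht t)};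
             tV = (\<lambda>t. conj_set (H \<times>\<times> K) (t, \<one>\<^bsub>K\<^esub>) V);
             t\<psi> = (\<lambda>t. conj_char (H \<times>\<times> K) (t, \<one>\<^bsub>K\<^esub>) \<psi>);
             W = (\<lambda>t. U O tV t);
             \<omega> = (\<lambda>t. star_char A U (tV t) \<phi> (t\<psi> t));
             X = coset_biset A (G \<times>\<times> H) U \<phi>;
             Y = coset_biset A (H \<times>\<times> K) V \<psi>;
             L = tensor A G H K X Y;
             M = coprod_gset T (\<lambda>t. coset_biset A (G \<times>\<times> K) (W t) (\<omega> t))
         in \<exists>f \<in> fibered_biset_iso A G K L M.
              \<forall>t \<in> T. inv_into (points L) f (t, twist A (W t) (\<omega> t)) =
                pair_class A G H K X Y
                  (twist A U \<phi>)
                  ((\<one>\<^bsub>A\<^esub>, t, \<one>\<^bsub>K\<^esub>) <#\<^bsub>A \<times>\<times> H \<times>\<times> K\<^esub> twist A V \<psi>)"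
proof -
  interpret coset_biset_pair A G H K U \<phi> V \<psi>
    using assms by (simp add: coset_biset_pair_def coset_biset_pair_axioms_def)
  have "restrict (char2 A G \<phi>) (Ht t) = restrict (conj_char H t (char1 K \<psi>)) (Ht t) \<longleftrightarrow> compatible t" for t
    unfolding compatible_def restrict_def fun_eq_iff by auto
  then show ?thesis
    unfolding Let_def using mackey_formula[OF assms(10), unfolded base_class_def] by (simp only:)
qed

end
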